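(* Let $\{(\xi_k,\eta_k,q_k)\}_{k=0}^{\infty}$ be a stationary ergodic (with respect to the translation $k\mapsto k+1$) sequence of random vectors in $\mathbb{R}^3$ on a probability space $(\Omega,\mathcal F,P)$ such that $\mathsf E\ln(1+|q_0|)$, $\mathsf E\xi_0$ and $\mathsf E\eta_0$ are finite. Let $J_n$ be the associated random $n\times n$ tridiagonal matrices with periodic corner entries, let $\bar\gamma(z)$ be the associated Lyapunov exponent, let $g=\frac12\mathsf E(\eta_0-\xi_0)$, and let $$D_1=\{z\in\mathbb{C}:\bar\gamma(z)>|g|\},\qquad D_2=\{z\in\mathbb{C}:\bar\gamma(z)<|g|\}.$$ Then for $P$-almost all $\omega=\{(\xi_j,\eta_j,q_j)\}_{j=0}^{\infty}$ the following two statements hold: (a) For every compact set $K_1\subset D_1\setminus\mathbb{R}$ there exists an integer $n_1(K_1,\omega)$ such that for all $n>n_1(K_1,\omega)$ there are no eigenvalues of $J_n$ in $K_1$. (b) For every compact set $K_2\subset D_2$ there exists an integer $n_2(K_2,\omega)$ such that for all $n>n_2(K_2,\omega)$ there are no eigenvalues of $J_n$ in $K_2$.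
   Context: $\mathsf E$ denotes expectation with respect to $P$. The matrix $J_n$ ($n\ge 3$) is the real $n\times n$ matrix whose only nonzero entries are: diagonal entries $(J_n)_{k,k}=q_k$ for $1\le k\le n$; $(J_n)_{k,k+1}=-e^{\eta_k}$ and $(J_n)_{k+1,k}=-e^{\xi_k}$ for $1\le k\le n-1$; and corner entries $(J_n)_{1,n}=-e^{\xi_0}$, $(J_n)_{n,1}=-e^{\eta_n}$. Put $c_k=e^{\frac12(\xi_k+\eta_k)}$ for $k\ge 0$ and, for $z\in\mathbb{C}$, $$A_k=\frac1{c_k}\begin{pmatrix} q_k-z & -c_{k-1}\\ c_k & 0\end{pmatrix}\ (k\ge1),\qquad S_n(z)=A_nA_{n-1}\cdots A_1 .$$ The Lyapunov exponent is $\bar\gamma(z)=\lim_{n\to\infty}\frac1n\mathsf E\log\|S_n(z)\|$, where $\|M\|=\max_k\sum_j|M_{jk}|$; it is a known fact that this limit exists for every $z\in\mathbb{C}$ and is non-negative. *)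

theory Defs
  imports "HOL-Probability.Probability" "Jordan_Normal_Form.Char_Poly"
begin

text \<open>
  A process \<open>X\<close> is identified with the random sequence \<open>\<omega> \<mapsto> (X 0 \<omega>, X 1 \<omega>, \<dots>)\<close>, whose law
  is a measure on the product space \<open>\<Pi>\<^sub>M k\<in>UNIV. borel\<close>.
\<close>

definition path_law :: "'a measure \<Rightarrow> (nat \<Rightarrow> 'a \<Rightarrow> 'b::topological_space) \<Rightarrow> (nat \<Rightarrow> 'b) measure" where
  "path_law M X = distr M (\<Pi>\<^sub>M k\<in>UNIV. borel) (\<lambda>\<omega> k. X k \<omega>)"

definition seq_shift :: "(nat \<Rightarrow> 'b) \<Rightarrow> nat \<Rightarrow> 'b" where
  "seq_shift x = (\<lambda>k. x (Suc k))"

definition stationary_process :: "'a measure \<Rightarrow> (nat \<Rightarrow> 'a \<Rightarrow> 'b::topological_space) \<Rightarrow> bool" where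
  "stationary_process M X \<longleftrightarrow>
     (\<forall>k. X k \<in> borel_measurable M) \<and> path_law M (\<lambda>k. X (Suc k)) = path_law M X"

definition ergodic_process :: "'a measure \<Rightarrow> (nat \<Rightarrow> 'a \<Rightarrow> 'b::topological_space) \<Rightarrow> bool" where
  "ergodic_process M X \<longleftrightarrow>
     (\<forall>A \<in> sets (\<Pi>\<^sub>M k\<in>(UNIV::nat set). (borel :: 'b measure)).
        seq_shift -` A = A \<longrightarrow> measure (path_law M X) A \<in> {0, 1})"

text \<open>
  Matrices of the library are indexed from \<open>0\<close>, hence the shift of the row and column indices.
  The matrix is meant for \<open>n \<ge> 3\<close>, where the clauses of the entry function do not overlap;
  smaller \<open>n\<close> play no role in statements about all large \<open>n\<close>.
\<close>

definition J_entry ::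
  "nat \<Rightarrow> (nat \<Rightarrow> real) \<Rightarrow> (nat \<Rightarrow> real) \<Rightarrow> (nat \<Rightarrow> real) \<Rightarrow> nat \<Rightarrow> nat \<Rightarrow> real" where
  "J_entry n \<xi> \<eta> q k l =
     (if l = k then q k
      else if l = k + 1 then - exp (\<eta> k)
      else if k = l + 1 then - exp (\<xi> l)
      else if k = 1 \<and> l = n then - exp (\<xi> 0)
      else if k = n \<and> l = 1 then - exp (\<eta> n)
      else 0)"

definition J_mat :: "nat \<Rightarrow> (nat \<Rightarrow> real) \<Rightarrow> (nat \<Rightarrow> real) \<Rightarrow> (nat \<Rightarrow> real) \<Rightarrow> real mat" where
  "J_mat n \<xi> \<eta> q = mat n n (\<lambda>(i, j). J_entry n \<xi> \<eta> q (i + 1) (j + 1))"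

definition off_diag :: "(nat \<Rightarrow> real) \<Rightarrow> (nat \<Rightarrow> real) \<Rightarrow> nat \<Rightarrow> real" where
  "off_diag \<xi> \<eta> k = exp ((\<xi> k + \<eta> k) / 2)"

text \<open>The following matrix is only used for \<open>k \<ge> 1\<close>.\<close>

definition A_mat ::
  "(nat \<Rightarrow> real) \<Rightarrow> (nat \<Rightarrow> real) \<Rightarrow> (nat \<Rightarrow> real) \<Rightarrow> complex \<Rightarrow> nat \<Rightarrow> complex mat" where
  "A_mat \<xi> \<eta> q z k =
     (1 / complex_of_real (off_diag \<xi> \<eta> k)) \<cdot>\<^sub>m
       mat_of_rows_list 2
         [[complex_of_real (q k) - z, - complex_of_real (off_diag \<xi> \<eta> (k - 1))],
          [complex_of_real (off_diag \<xi> \<eta> k), 0]]"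

primrec S_mat ::
  "(nat \<Rightarrow> real) \<Rightarrow> (nat \<Rightarrow> real) \<Rightarrow> (nat \<Rightarrow> real) \<Rightarrow> complex \<Rightarrow> nat \<Rightarrow> complex mat" where
  "S_mat \<xi> \<eta> q z 0 = 1\<^sub>m 2"
| "S_mat \<xi> \<eta> q z (Suc n) = A_mat \<xi> \<eta> q z (Suc n) * S_mat \<xi> \<eta> q z n"

definition mat_norm :: "complex mat \<Rightarrow> real" where
  "mat_norm B = Max ((\<lambda>k. \<Sum>j<dim_row B. cmod (B $$ (j, k))) ` {..<dim_col B})"

text \<open>
  From here on the sequences are random, so they take an additional argument \<open>\<omega>\<close>.
\<close>

definition lyapunov ::
  "'a measure \<Rightarrow> (nat \<Rightarrow> 'a \<Rightarrow> real) \<Rightarrow> (nat \<Rightarrow> 'a \<Rightarrow> real) \<Rightarrow> (nat \<Rightarrow> 'a \<Rightarrow> real) \<Rightarrow> complex \<Rightarrow> real" where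
  "lyapunov M \<xi> \<eta> q z =
     lim (\<lambda>n. (LINT \<omega>|M. ln (mat_norm (S_mat (\<lambda>k. \<xi> k \<omega>) (\<lambda>k. \<eta> k \<omega>) (\<lambda>k. q k \<omega>) z n))) / real n)"

definition asym_g :: "'a measure \<Rightarrow> (nat \<Rightarrow> 'a \<Rightarrow> real) \<Rightarrow> (nat \<Rightarrow> 'a \<Rightarrow> real) \<Rightarrow> real" where
  "asym_g M \<xi> \<eta> = (LINT \<omega>|M. \<eta> 0 \<omega> - \<xi> 0 \<omega>) / 2"

definition D1 ::
  "'a measure \<Rightarrow> (nat \<Rightarrow> 'a \<Rightarrow> real) \<Rightarrow> (nat \<Rightarrow> 'a \<Rightarrow> real) \<Rightarrow> (nat \<Rightarrow> 'a \<Rightarrow> real) \<Rightarrow> complex set" where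
  "D1 M \<xi> \<eta> q = {z. lyapunov M \<xi> \<eta> q z > \<bar>asym_g M \<xi> \<eta>\<bar>}"

definition D2 ::
  "'a measure \<Rightarrow> (nat \<Rightarrow> 'a \<Rightarrow> real) \<Rightarrow> (nat \<Rightarrow> 'a \<Rightarrow> real) \<Rightarrow> (nat \<Rightarrow> 'a \<Rightarrow> real) \<Rightarrow> complex set" where
  "D2 M \<xi> \<eta> q = {z. lyapunov M \<xi> \<eta> q z < \<bar>asym_g M \<xi> \<eta>\<bar>}"

end

theory Submission
  imports Defs
begin

text \<open>
  A gauge transformation turns \<open>J\<^sub>n \<psi> = z \<psi>\<close> into \<open>S\<^sub>n(z) u = diag (d\<^sub>1, d\<^sub>2) u\<close> with \<open>d\<^sub>1\<close> and \<open>d\<^sub>2\<close> both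
  of size \<open>exp (n (g + o(1)))\<close>, so an eigenvalue satisfies \<open>det S\<^sub>n + d\<^sub>1 d\<^sub>2 = d\<^sub>2 S\<^sub>1\<^sub>1 + d\<^sub>1 S\<^sub>2\<^sub>2\<close>. The left
  side is positive, of size \<open>exp (n (g + \<bar>g\<bar> + o(1)))\<close>. The right side is at most
  \<open>exp (n (g + \<gamma>(z) + o(1)))\<close>, which is too small if \<open>\<gamma>(z) < \<bar>g\<bar>\<close>; for non-real \<open>z\<close> it is also at least
  that large, which is too large if \<open>\<gamma>(z) > \<bar>g\<bar>\<close>.

  For the lower bound, the ratios of the entries of \<open>S\<^sub>n\<close> obey Riccati recursions that preserve a
  half-plane property. Hence \<open>S\<^sub>1\<^sub>1\<close> controls both \<open>d\<^sub>2 S\<^sub>1\<^sub>1 + d\<^sub>1 S\<^sub>2\<^sub>2\<close> and the norm of \<open>S\<^sub>n\<close>, and \<open>ln \<bar>S\<^sub>1\<^sub>1\<bar>\<close> is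
  superadditive along the orbit up to an integrable error; it varies slowly with \<open>z\<close> because \<open>S\<^sub>1\<^sub>1\<close> is a
  polynomial in \<open>z\<close> with real roots. Both growth bounds then follow from Birkhoff's theorem applied to
  blocks of a fixed length, locally uniformly in \<open>z\<close>.
\<close>

section \<open>Birkhoff's ergodic theorem\<close>

primrec bsum :: "('a \<Rightarrow> 'a) \<Rightarrow> ('a \<Rightarrow> real) \<Rightarrow> nat \<Rightarrow> 'a \<Rightarrow> real" where
  "bsum T f 0 x = 0"
| "bsum T f (Suc n) x = f x + bsum T f n (T x)"

lemma bsum_eq_sum: "bsum T f n x = (\<Sum>k<n. f ((T ^^ k) x))"
  by (induction n arbitrary: x) (simp_all add: sum.lessThan_Suc_shift funpow_swap1 del: sum.lessThan_Suc)

text \<open>The maximum of \<open>bsum T f k x\<close> over \<open>k \<le> n\<close>; this recursive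
  form is the identity on which the maximal inequality rests.\<close>

primrec max_bsum :: "('a \<Rightarrow> 'a) \<Rightarrow> ('a \<Rightarrow> real) \<Rightarrow> nat \<Rightarrow> 'a \<Rightarrow> real" where
  "max_bsum T f 0 x = 0"
| "max_bsum T f (Suc n) x = max 0 (f x + max_bsum T f n (T x))"

lemma max_bsum_nonneg: "max_bsum T f n x \<ge> 0"
  by (cases n) auto

lemma max_bsum_mono_Suc: "max_bsum T f n x \<le> max_bsum T f (Suc n) x"
proof (induction n arbitrary: x)
  case (Suc n)
  have "max_bsum T f n (T x) \<le> max_bsum T f (Suc n) (T x)" by (rule Suc)
  then show ?case unfolding max_bsum.simps(2)[of T f _ x] by simp
qed simp

lemma max_bsum_mono: "m \<le> n \<Longrightarrow> max_bsum T f m x \<le> max_bsum T f n x"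
  by (rule lift_Suc_mono_le[of "\<lambda>n. max_bsum T f n x"]) (simp_all add: max_bsum_mono_Suc del: max_bsum.simps)

lemma bsum_le_max_bsum: "bsum T f n x \<le> max_bsum T f n x"
  by (induction n arbitrary: x) (simp_all add: le_max_iff_disj)

section \<open>Measure-preserving maps and the maximal ergodic inequality\<close>

locale measure_preserving = prob_space N for N :: "'a measure" +
  fixes T :: "'a \<Rightarrow> 'a"
  assumes T_measurable [measurable]: "T \<in> measurable N N"
    and T_invariant: "distr N N T = N"
begin

lemma measurable_funpow [measurable]: "T ^^ k \<in> measurable N N"
  by (induction k) (auto intro: measurable_comp simp: funpow_Suc_right id_def simp del: funpow.simps(2) o_apply)

lemma distr_funpow: "distr N N (T ^^ k) = N"
proof (induction k)
  case (Suc k)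
  have "distr N N (T ^^ Suc k) = distr (distr N N T) N (T ^^ k)"
    by (subst distr_distr) (auto simp: funpow_Suc_right simp del: funpow.simps(2))
  then show ?case by (simp add: T_invariant Suc del: funpow.simps(2))
qed (simp add: distr_id2 id_def)

lemma integrable_funpow:
  fixes f :: "'a \<Rightarrow> real"
  assumes "integrable N f" shows "integrable N (\<lambda>x. f ((T ^^ k) x))"
  using assms integrable_distr[of "T ^^ k" N N f] by (simp add: distr_funpow)

lemma integral_funpow:
  fixes f :: "'a \<Rightarrow> real"
  assumes "f \<in> borel_measurable N" shows "(LINT x|N. f ((T ^^ k) x)) = (LINT x|N. f x)"
  using integral_distr[of "T ^^ k" N N f] assms by (simp add: distr_funpow)

lemmas integrable_T = integrable_funpow[of _ 1, simplified]
lemmas integral_T = integral_funpow[of _ 1, simplified]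

lemma integrable_max_bsum: "integrable N f \<Longrightarrow> integrable N (\<lambda>x. max_bsum T f n x)"
proof (induction n)
  case 0
  have "max_bsum T f 0 = (\<lambda>x. 0)" by (rule ext) simp
  then show ?case by simp
next
  case (Suc n)
  have "max_bsum T f (Suc n) = (\<lambda>x. max 0 (f x + max_bsum T f n (T x)))" by (rule ext) simp
  with integrable_T[OF Suc.IH[OF Suc.prems]] Suc.prems show ?case by simp
qed

text \<open>Garsia's argument. Where the maximum is positive, it is at most
  \<open>f x + max_bsum T f n (T x)\<close> by the recursion; elsewhere it is zero. Integration
  leaves the claim, because \<open>T\<close> preserves the integral of the maximum.\<close>

lemma maximal_inequality:
  assumes f: "integrable N f"
  shows "(LINT x|N. indicator {x\<in>space N. 0 < max_bsum T f n x} x * f x) \<ge> 0"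
proof (cases n)
  case (Suc m)
  note [measurable] = borel_measurable_integrable[OF f]
    borel_measurable_integrable[OF integrable_max_bsum[OF f]]
  have "0 = (LINT x|N. max_bsum T f n x) - (LINT x|N. max_bsum T f n (T x))"
    by (simp add: integral_T)
  also have "\<dots> = (LINT x|N. max_bsum T f n x - max_bsum T f n (T x))"
    by (rule Bochner_Integration.integral_diff[symmetric]) (intro integrable_max_bsum integrable_T[OF integrable_max_bsum] f)+
  also have "\<dots> \<le> (LINT x|N. indicator {x\<in>space N. 0 < max_bsum T f n x} x * f x)"
  proof (rule integral_mono)
    show "integrable N (\<lambda>x. max_bsum T f n x - max_bsum T f n (T x))"
      by (intro Bochner_Integration.integrable_diff integrable_max_bsum
          integrable_T[OF integrable_max_bsum] f)
    show "integrable N (\<lambda>x. indicator {x\<in>space N. 0 < max_bsum T f n x} x * f x)"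
      using integrable_mult_indicator[OF _ f, of "{x\<in>space N. 0 < max_bsum T f n x}"] by simp
    fix x assume x: "x \<in> space N"
    show "max_bsum T f n x - max_bsum T f n (T x) \<le> indicator {x\<in>space N. 0 < max_bsum T f n x} x * f x"
    proof (cases "0 < max_bsum T f n x")
      case True
      then have "max_bsum T f n x = f x + max_bsum T f m (T x)" by (auto simp: Suc)
      moreover have "max_bsum T f m (T x) \<le> max_bsum T f n (T x)"
        unfolding Suc by (rule max_bsum_mono_Suc)
      ultimately show ?thesis using True x by simp
    next
      case False
      then show ?thesis using max_bsum_nonneg[of T f n "T x"] by simp
    qed
  qed
  finally show ?thesis .
qed simp

end

section \<open>Birkhoff's theorem for ergodic systems\<close>

locale ergodic_system = measure_preserving +
  assumes ergodic: "A \<in> sets N \<Longrightarrow> T -` A \<inter> space N = A \<Longrightarrow> prob A \<in> {0, 1}"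
begin

text \<open>The set where the maxima are unbounded is invariant, so its probability is 0 or 1. If it
  were 1, the indicators in the maximal inequality would tend to 1, and the limit would force a
  nonnegative mean.\<close>

lemma bsum_bounded_above:
  assumes f: "integrable N f" and neg: "(LINT x|N. f x) < 0"
  shows "AE x in N. \<exists>B. \<forall>n. bsum T f n x \<le> B"
proof -
  note [measurable] = borel_measurable_integrable[OF f]
    borel_measurable_integrable[OF integrable_max_bsum[OF f]]
  define A where "A = {x\<in>space N. \<forall>B::nat. \<exists>n. max_bsum T f n x > real B}"
  have A: "A \<in> sets N" unfolding A_def by measurable
  \<comment> \<open>Passing from \<open>x\<close> to \<open>T x\<close> lowers the index by one and
    changes the maximum by at most \<open>\<bar>f x\<bar>\<close>.\<close>
  have unbounded_iff: "(\<forall>B::nat. \<exists>n. max_bsum T f n x > real B) \<longleftrightarrow>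
      (\<forall>B::nat. \<exists>n. max_bsum T f n (T x) > real B)" for x
  proof safe
    fix B :: nat
    assume *: "\<forall>B::nat. \<exists>n. max_bsum T f n x > real B"
    obtain C :: nat where C: "real C \<ge> \<bar>f x\<bar> + real B" using real_arch_simple by blast
    obtain n where n: "max_bsum T f n x > real C" using * by blast
    then obtain m where "n = Suc m" by (cases n) auto
    with n C have "max_bsum T f m (T x) > real B" by (auto simp: max_def split: if_splits)
    then show "\<exists>n. max_bsum T f n (T x) > real B" ..
  next
    fix B :: nat
    assume *: "\<forall>B::nat. \<exists>n. max_bsum T f n (T x) > real B"
    obtain C :: nat where C: "real C \<ge> \<bar>f x\<bar> + real B" using real_arch_simple by blast
    obtain n where n: "max_bsum T f n (T x) > real C" using * by blast
    with C have "max_bsum T f (Suc n) x > real B" by auto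
    then show "\<exists>n. max_bsum T f n x > real B" ..
  qed
  have "T -` A \<inter> space N = A"
    using unbounded_iff measurable_space[OF T_measurable] unfolding A_def by blast
  with A have "prob A \<in> {0, 1}" by (rule ergodic)
  moreover have "prob A \<noteq> 1"
  proof
    assume "prob A = 1"
    then have "AE x in N. x \<in> A" using A by (simp add: prob_eq_1)
    then have ev: "AE x in N. (\<lambda>n. indicator {x\<in>space N. 0 < max_bsum T f n x} x * f x) \<longlonglongrightarrow> f x"
    proof eventually_elim
      case (elim x)
      then have "\<forall>B::nat. \<exists>n. max_bsum T f n x > real B" by (simp add: A_def)
      from spec[OF this, of 0] obtain m where m: "max_bsum T f m x > 0" by auto
      have "\<forall>\<^sub>F n in sequentially. indicator {x\<in>space N. 0 < max_bsum T f n x} x * f x = f x"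
      proof (rule eventually_sequentiallyI)
        fix n assume "m \<le> n"
        then have "max_bsum T f n x > 0" using m max_bsum_mono[of m n T f x] by linarith
        then show "indicator {x\<in>space N. 0 < max_bsum T f n x} x * f x = f x"
          using elim by (simp add: A_def)
      qed
      then show ?case by (rule tendsto_eventually)
    qed
    have "(\<lambda>n. LINT x|N. indicator {x\<in>space N. 0 < max_bsum T f n x} x * f x) \<longlonglongrightarrow> (LINT x|N. f x)"
      by (rule integral_dominated_convergence[where w = "\<lambda>x. \<bar>f x\<bar>"])
        (use f ev in \<open>auto simp: indicator_def\<close>)
    then have "(LINT x|N. f x) \<ge> 0"
      by (rule LIMSEQ_le_const) (intro exI[of _ 0] allI impI maximal_inequality[OF f])
    with neg show False by simp
  qed
  ultimately have "prob A = 0" by blast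
  then have "AE x in N. x \<notin> A" using A prob_eq_0 by blast
  with AE_space show ?thesis
  proof eventually_elim
    case (elim x)
    then have "\<exists>B::nat. \<forall>n. max_bsum T f n x \<le> real B" by (simp add: A_def not_less)
    then obtain B :: nat where "\<And>n. max_bsum T f n x \<le> real B" by blast
    then have "\<forall>n. bsum T f n x \<le> real B" by (intro allI order_trans[OF bsum_le_max_bsum])
    then show ?case ..
  qed
qed

lemma bsum_diff_const: "bsum T (\<lambda>x. f x - c) n x = bsum T f n x - real n * c"
  by (simp add: bsum_eq_sum sum_subtractf)

lemma bsum_upper:
  assumes f: "integrable N f" and c: "(LINT x|N. f x) < c"
  shows "AE x in N. \<exists>B. \<forall>n. bsum T f n x \<le> B + real n * c"
proof -
  have "AE x in N. \<exists>B. \<forall>n. bsum T (\<lambda>x. f x - c) n x \<le> B"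
    by (rule bsum_bounded_above) (use assms in \<open>auto simp: prob_space\<close>)
  then show ?thesis by eventually_elim (simp add: bsum_diff_const algebra_simps)
qed

lemma birkhoff_limsup:
  assumes f: "integrable N f" and c: "(LINT x|N. f x) < c"
  shows "AE x in N. \<forall>\<^sub>F n in sequentially. bsum T f n x < real n * c"
proof -
  \<comment> \<open>The smaller slope \<open>d\<close> leaves room to absorb the additive constant
    \<open>B\<close>.\<close>
  obtain d where d: "(LINT x|N. f x) < d" "d < c" using c dense by blast
  from bsum_upper[OF f d(1)] show ?thesis
  proof eventually_elim
    case (elim x)
    then obtain B where B: "\<And>n. bsum T f n x \<le> B + real n * d" by blast
    have "\<forall>\<^sub>F n in sequentially. real n > B / (c - d)"
      by (rule eventually_gt_at_top[THEN eventually_compose_filterlim, OF filterlim_real_sequentially])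
    then show ?case
    proof eventually_elim
      case (elim n)
      then have "B < real n * (c - d)" using d by (simp add: pos_divide_less_eq)
      then show ?case using B[of n] by (simp add: algebra_simps)
    qed
  qed
qed

theorem birkhoff:
  assumes f: "integrable N f"
  shows "AE x in N. (\<lambda>n. bsum T f n x / real n) \<longlonglongrightarrow> (LINT x|N. f x)"
proof -
  let ?I = "LINT x|N. f x"
  have "AE x in N. \<forall>\<^sub>F n in sequentially. bsum T f n x < real n * (?I + 1 / real (Suc k))" for k
    by (rule birkhoff_limsup[OF f]) simp
  moreover have "AE x in N. \<forall>\<^sub>F n in sequentially. bsum T (\<lambda>x. - f x) n x < real n * (- ?I + 1 / real (Suc k))" for k
    by (rule birkhoff_limsup) (use f in simp_all)
  ultimately have "AE x in N. \<forall>k. (\<forall>\<^sub>F n in sequentially. bsum T f n x < real n * (?I + 1 / real (Suc k))) \<and>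
     (\<forall>\<^sub>F n in sequentially. bsum T (\<lambda>x. - f x) n x < real n * (- ?I + 1 / real (Suc k)))"
    by (simp add: AE_all_countable)
  then show ?thesis
  proof eventually_elim
    case (elim x)
    show ?case
    proof (rule tendstoI)
      fix e :: real assume "e > 0"
      then obtain k where k: "1 / real (Suc k) < e" using nat_approx_posE by blast
      from elim[rule_format, of k, THEN conjunct1] elim[rule_format, of k, THEN conjunct2]
        eventually_gt_at_top[of 0]
      show "\<forall>\<^sub>F n in sequentially. dist (bsum T f n x / real n) ?I < e"
      proof eventually_elim
        case (elim n)
        have "bsum T (\<lambda>x. - f x) n x = - bsum T f n x" by (simp add: bsum_eq_sum sum_negf)
        with elim have "bsum T f n x / real n < ?I + 1 / real (Suc k)"
          "?I - 1 / real (Suc k) < bsum T f n x / real n"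
          by (simp_all only: pos_divide_less_eq pos_less_divide_eq of_nat_0_less_iff)
            (simp_all add: algebra_simps)
        with k show ?case by (simp add: dist_real_def abs_less_iff)
      qed
    qed
  qed
qed

text \<open>A single orbit term is the difference of two consecutive Birkhoff sums, whose averages
  have the same limit.\<close>

corollary orbit_sublinear:
  assumes f: "integrable N f"
  shows "AE x in N. (\<lambda>n. f ((T ^^ n) x) / real n) \<longlonglongrightarrow> 0"
  using birkhoff[OF f]
proof eventually_elim
  case (elim x)
  let ?I = "LINT x|N. f x"
  have "(\<lambda>n. bsum T f (Suc n) x / real (Suc n) * (real (Suc n) / real n) - bsum T f n x / real n)
     \<longlonglongrightarrow> ?I * 1 - ?I"
    by (intro tendsto_diff tendsto_mult elim LIMSEQ_Suc[OF elim] LIMSEQ_Suc_n_over_n)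
  moreover have "bsum T f (Suc n) x / real (Suc n) * (real (Suc n) / real n) - bsum T f n x / real n
      = f ((T ^^ n) x) / real n" for n
  proof -
    have "bsum T f (Suc n) x = bsum T f n x + f ((T ^^ n) x)" by (simp only: bsum_eq_sum sum.lessThan_Suc)
    then show ?thesis by (simp add: diff_divide_distrib[symmetric] del: bsum.simps of_nat_Suc)
  qed
  ultimately show ?case by simp
qed

end

section \<open>Subadditive sequences and processes\<close>

text \<open>Fekete's argument: divide \<open>n\<close> with remainder by an \<open>m\<close> that
  nearly attains the infimum of \<open>a n / real n\<close>. Nonnegativity keeps that infimum
  finite.\<close>

lemma subadditive_convergent:
  fixes a :: "nat \<Rightarrow> real"
  assumes sub: "\<And>m n. a (m + n) \<le> a m + a n" and nonneg: "\<And>n. a n \<ge> 0"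
  shows "convergent (\<lambda>n. a n / real n)"
proof -
  define L where "L = (INF n\<in>{0<..}. a n / real n)"
  have bdd: "bdd_below ((\<lambda>n. a n / real n) ` {0<..})"
    by (rule bdd_belowI[of _ 0]) (auto simp: nonneg)
  have "(\<lambda>n. a n / real n) \<longlonglongrightarrow> L"
  proof (rule tendstoI)
    fix e :: real assume e: "e > 0"
    have "\<exists>m\<in>{0<..}. a m / real m < L + e / 2"
      using cINF_less_iff[OF _ bdd, of "L + e / 2"] e unfolding L_def by auto
    then obtain m where m: "m > 0" "a m / real m < L + e / 2" by auto
    \<comment> \<open>\<open>C\<close> dominates \<open>a r\<close> for every remainder
      \<open>r < m\<close>, since all terms are nonnegative.\<close>
    define C where "C = (\<Sum>r<m. a r)"
    have mult: "a (k * m + r) \<le> real k * a m + a r" for k r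
    proof (induction k)
      case (Suc k)
      have "a (Suc k * m + r) \<le> a m + a (k * m + r)" using sub[of m "k * m + r"] by (simp add: add.assoc)
      with Suc show ?case by (simp add: algebra_simps)
    qed simp
    have "\<forall>\<^sub>F n in sequentially. real n > C / (e / 2)"
      by (rule eventually_gt_at_top[THEN eventually_compose_filterlim, OF filterlim_real_sequentially])
    with eventually_gt_at_top[of 0]
    show "\<forall>\<^sub>F n in sequentially. dist (a n / real n) L < e"
    proof eventually_elim
      case (elim n)
      have "a n \<le> real (n div m) * a m + a (n mod m)" using mult[of "n div m" "n mod m"] by simp
      also have "a (n mod m) \<le> C" unfolding C_def
        by (rule member_le_sum) (use m nonneg in auto)
      also have "real (n div m) * a m \<le> real n / real m * a m"
        by (intro mult_right_mono nonneg of_nat_div_le_of_nat)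
      finally have "a n / real n \<le> a m / real m + C / real n"
        using elim m by (simp add: field_simps)
      moreover have "C / real n < e / 2" using elim e by (simp add: field_simps)
      moreover have "L \<le> a n / real n" unfolding L_def
        by (rule cINF_lower[OF bdd]) (use elim in auto)
      ultimately have "\<bar>a n / real n - L\<bar> < e" using m(2) unfolding abs_less_iff by linarith
      then show ?case by (simp add: dist_real_def)
    qed
  qed
  then show ?thesis by (auto simp: convergent_def)
qed

text \<open>
  With \<open>V\<^sub>N x = (\<Sum>r\<le>m. \<phi> (N + m - r) (T\<^sup>r x))\<close>, subadditivity gives
  \<open>V\<^sub>N\<^sub>+\<^sub>1 x - V\<^sub>N (T x) = \<phi> (N + 1 + m) x - \<phi> N (T\<^sup>m\<^sup>+\<^sup>1 x) \<le> \<phi> (m + 1) x\<close>,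
  which replaces the usual bookkeeping of residues modulo the block length.
\<close>

lemma subadditive_block_bound:
  fixes \<phi> :: "nat \<Rightarrow> 'a \<Rightarrow> real"
  assumes sub: "\<And>n k x. \<phi> (n + k) x \<le> \<phi> k x + \<phi> n ((T ^^ k) x)"
  shows "real (Suc m) * \<phi> (N + m) x \<le>
    (\<Sum>r\<le>m. \<phi> r x) + bsum T (\<phi> (Suc m)) N x + (\<Sum>r\<le>m. \<phi> (m - r) ((T ^^ r) ((T ^^ N) x)))"
proof -
  define V where "V N x = (\<Sum>r\<le>m. \<phi> (N + (m - r)) ((T ^^ r) x))" for N x
  have V_Suc: "V (Suc N) x \<le> \<phi> (Suc m) x + V N (T x)" for N x
  proof -
    \<comment> \<open>Both sums are windows of the one sequence \<open>g\<close>, shifted by one, so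
      only its end terms survive in the difference.\<close>
    define g where "g r = \<phi> (N + (Suc m - r)) ((T ^^ r) x)" for r
    have "V (Suc N) x = (\<Sum>r\<le>m. g r)"
      unfolding V_def g_def by (rule sum.cong) (auto simp: Suc_diff_le)
    moreover have "V N (T x) = (\<Sum>r\<le>m. g (Suc r))"
      unfolding V_def g_def by (rule sum.cong) (auto simp: funpow_swap1)
    moreover have "(\<Sum>r\<le>m. g r) + g (Suc m) = g 0 + (\<Sum>r\<le>m. g (Suc r))"
      by (metis sum.atMost_Suc sum.atMost_Suc_shift)
    moreover have "g 0 \<le> \<phi> (Suc m) x + g (Suc m)"
      using sub[of N "Suc m" x] by (simp add: g_def)
    ultimately show ?thesis by linarith
  qed
  have V_le: "V N x \<le> bsum T (\<phi> (Suc m)) N x + V 0 ((T ^^ N) x)" for x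
  proof (induction N arbitrary: x)
    case (Suc N)
    from V_Suc[of N x] Suc[of "T x"] show ?case by (simp add: funpow_swap1)
  qed simp
  have "real (Suc m) * \<phi> (N + m) x = (\<Sum>r\<le>m. \<phi> (N + m) x)" by simp
  also have "\<dots> \<le> (\<Sum>r\<le>m. \<phi> r x + \<phi> (N + (m - r)) ((T ^^ r) x))"
  proof (rule sum_mono)
    fix r assume "r \<in> {..m}"
    then show "\<phi> (N + m) x \<le> \<phi> r x + \<phi> (N + (m - r)) ((T ^^ r) x)"
      using sub[of "N + (m - r)" r x] by simp
  qed
  also have "\<dots> = (\<Sum>r\<le>m. \<phi> r x) + V N x" by (simp add: sum.distrib V_def)
  finally show ?thesis using V_le[of x] by (simp add: V_def)
qed

context ergodic_system
begin

text \<open>The upper half of Kingman's theorem, uniformly over \<open>W\<close>. After the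
  majorants are inserted, the right side of the block bound no longer involves \<open>w\<close>, so
  one null set and one threshold serve all parameters.\<close>

lemma subadditive_limsup:
  fixes \<phi> :: "'w \<Rightarrow> nat \<Rightarrow> 'a \<Rightarrow> real"
  assumes m: "m > 0"
    and sub: "\<And>w n k x. w \<in> W \<Longrightarrow> \<phi> w (n + k) x \<le> \<phi> w k x + \<phi> w n ((T ^^ k) x)"
    and F: "\<And>w x. w \<in> W \<Longrightarrow> \<phi> w m x \<le> F x" "integrable N F"
    and u: "\<And>w r x. w \<in> W \<Longrightarrow> r < m \<Longrightarrow> \<phi> w r x \<le> u x" "integrable N u"
    and c: "(LINT x|N. F x) < real m * c"
  shows "AE x in N. \<forall>\<^sub>F n in sequentially. \<forall>w\<in>W. \<phi> w n x < real n * c"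
proof -
  obtain p where p: "m = Suc p" using m by (cases m) auto
  define v where "v x = (\<Sum>r\<le>p. u ((T ^^ r) x))" for x
  \<comment> \<open>\<open>f\<close> differs from \<open>F\<close> by a coboundary: it has the same
    integral, and its Birkhoff sums already contain the end term \<open>v ((T ^^ n) x)\<close> of
    the block bound.\<close>
  define f where "f x = F x + v (T x) - v x" for x
  have v: "integrable N v" unfolding v_def by (intro Bochner_Integration.integrable_sum integrable_funpow u)
  have f: "integrable N f" unfolding f_def by (intro Bochner_Integration.integrable_add
        Bochner_Integration.integrable_diff integrable_T F v)
  have "(LINT x|N. f x) = (LINT x|N. F x)"
    unfolding f_def using v F by (simp add: integrable_T integral_T)
  then obtain d where d: "(LINT x|N. f x) < d" "d < real m * c" using c dense by force
  have bsum_f: "bsum T f n x = bsum T F n x + v ((T ^^ n) x) - v x" for n x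
    by (induction n arbitrary: x) (auto simp: f_def funpow_swap1)
  from bsum_upper[OF f d(1)] show ?thesis
  proof eventually_elim
    case (elim x)
    then obtain B where B: "\<And>n. bsum T f n x \<le> B + real n * d" by blast
    \<comment> \<open>The last term pays for replacing \<open>k = n - p\<close> by \<open>n\<close>
      in \<open>real k * d\<close>, whatever the sign of \<open>d\<close>.\<close>
    define B' where "B' = real m * u x + v x + B + real p * \<bar>d\<bar>"
    have "\<forall>\<^sub>F n in sequentially. real n > B' / (real m * c - d)"
      by (rule eventually_gt_at_top[THEN eventually_compose_filterlim, OF filterlim_real_sequentially])
    then show ?case using eventually_ge_at_top[of p]
    proof eventually_elim
      case (elim n)
      show ?case
      proof
        fix w assume w: "w \<in> W"
        obtain k where n: "n = k + p" using elim(2) le_Suc_ex add.commute by metis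
        have "real m * \<phi> w n x \<le> (\<Sum>r\<le>p. \<phi> w r x) + bsum T (\<phi> w m) k x
            + (\<Sum>r\<le>p. \<phi> w (p - r) ((T ^^ r) ((T ^^ k) x)))"
          unfolding p n by (rule subadditive_block_bound[OF sub[OF w]])
        also have "\<dots> \<le> (\<Sum>r\<le>p. u x) + bsum T F k x + v ((T ^^ k) x)"
          unfolding v_def bsum_eq_sum by (intro add_mono sum_mono F u w) (auto simp: p)
        also have "\<dots> = real m * u x + v x + bsum T f k x" by (simp add: bsum_f p)
        also have "\<dots> \<le> real m * u x + v x + B + real k * d" using B[of k] by simp
        also have "\<dots> \<le> B' + real n * d"
        proof -
          have "- (real p * d) \<le> real p * \<bar>d\<bar>"
            by (metis abs_ge_minus_self mult_left_mono mult_minus_right of_nat_0_le_iff)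
          then show ?thesis by (simp add: B'_def n algebra_simps)
        qed
        also have "\<dots> < real n * (real m * c)"
          using elim(1) d by (simp add: pos_divide_less_eq algebra_simps)
        finally have "real m * \<phi> w n x < real m * (real n * c)" by (simp add: mult.left_commute)
        then show "\<phi> w n x < real n * c" using m by simp
      qed
    qed
  qed
qed

end

section \<open>Transfer matrices along a fixed path\<close>

type_synonym env = "real \<times> real \<times> real"

definition log_c :: "env \<Rightarrow> real" where
  "log_c e = (fst e + fst (snd e)) / 2"

text \<open>The logarithm of the factor by which the symmetrising gauge changes from one site to the
  next; its mean is \<open>asym_g\<close>.\<close>

definition log_h :: "env \<Rightarrow> real" where
  "log_h e = (fst (snd e) - fst e) / 2"

abbreviation pot :: "env \<Rightarrow> real" where
  "pot e \<equiv> snd (snd e)"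

abbreviation cc :: "(nat \<Rightarrow> env) \<Rightarrow> nat \<Rightarrow> real" where
  "cc x k \<equiv> exp (log_c (x k))"

abbreviation S_path :: "(nat \<Rightarrow> env) \<Rightarrow> complex \<Rightarrow> nat \<Rightarrow> complex mat" where
  "S_path x \<equiv> S_mat (\<lambda>k. fst (x k)) (\<lambda>k. fst (snd (x k))) (\<lambda>k. snd (snd (x k)))"

definition S_entry :: "(nat \<Rightarrow> env) \<Rightarrow> complex \<Rightarrow> nat \<Rightarrow> nat \<Rightarrow> nat \<Rightarrow> complex" where
  "S_entry x z n i j = S_path x z n $$ (i, j)"

lemma S_mat_carrier: "S_mat \<xi> \<eta> q z n \<in> carrier_mat 2 2"
proof (induction n)
  case (Suc n)
  have "A_mat \<xi> \<eta> q z (Suc n) \<in> carrier_mat 2 2"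
    by (simp add: A_mat_def mat_of_rows_list_def numeral_2_eq_2)
  with Suc show ?case by simp
qed simp

lemma S_0 [simp]: "i < 2 \<Longrightarrow> j < 2 \<Longrightarrow> S_entry x z 0 i j = (if i = j then 1 else 0)"
  by (simp add: S_entry_def)

lemma S_Suc_entry:
  assumes "i < 2" "j < 2"
  shows "S_entry x z (Suc n) i j =
    A_mat (\<lambda>k. fst (x k)) (\<lambda>k. fst (snd (x k))) (\<lambda>k. snd (snd (x k))) z (Suc n) $$ (i, 0) * S_entry x z n 0 j +
    A_mat (\<lambda>k. fst (x k)) (\<lambda>k. fst (snd (x k))) (\<lambda>k. snd (snd (x k))) z (Suc n) $$ (i, 1) * S_entry x z n 1 j"
proof -
  have "S_path x z n \<in> carrier_mat 2 2" by (rule S_mat_carrier)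
  with assms show ?thesis
    by (simp add: S_entry_def A_mat_def mat_of_rows_list_def scalar_prod_def numeral_2_eq_2)
qed

lemma S_Suc_0:
  "j < 2 \<Longrightarrow> S_entry x z (Suc n) 0 j =
    ((of_real (pot (x (Suc n))) - z) * S_entry x z n 0 j - of_real (cc x n) * S_entry x z n 1 j) / of_real (cc x (Suc n))"
  by (simp add: S_Suc_entry[of 0])
    (simp add: A_mat_def mat_of_rows_list_def off_diag_def log_c_def field_simps)

lemma S_Suc_1: "j < 2 \<Longrightarrow> S_entry x z (Suc n) 1 j = S_entry x z n 0 j"
  by (subst S_Suc_entry) (simp_all add: A_mat_def mat_of_rows_list_def off_diag_def)

lemmas S_Suc = S_Suc_0 S_Suc_1 S_Suc_1[simplified]

lemma mat_norm_S:
  "mat_norm (S_path x z n) =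
     max (cmod (S_entry x z n 0 0) + cmod (S_entry x z n 1 0)) (cmod (S_entry x z n 0 1) + cmod (S_entry x z n 1 1))"
proof -
  have "S_path x z n \<in> carrier_mat 2 2" by (rule S_mat_carrier)
  moreover have "{..<2::nat} = {0, 1}" by auto
  ultimately show ?thesis by (simp add: mat_norm_def S_entry_def)
qed

section \<open>The cocycle relation, the determinant and bounds for the norm\<close>

lemma seq_shift_funpow: "(seq_shift ^^ k) x j = x (j + k)"
  by (induction k arbitrary: j) (auto simp: seq_shift_def)

lemma S_add:
  assumes "j < 2"
  shows "S_entry x z (n + k) 0 j = S_entry ((seq_shift ^^ k) x) z n 0 0 * S_entry x z k 0 j + S_entry ((seq_shift ^^ k) x) z n 0 1 * S_entry x z k 1 j
    \<and> S_entry x z (n + k) 1 j = S_entry ((seq_shift ^^ k) x) z n 1 0 * S_entry x z k 0 j + S_entry ((seq_shift ^^ k) x) z n 1 1 * S_entry x z k 1 j"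
proof (induction n)
  case 0
  then show ?case by simp
next
  case (Suc n)
  define y where "y = (seq_shift ^^ k) x"
  have "x (n + k) = y n" "x (Suc (n + k)) = y (Suc n)" by (simp_all add: y_def seq_shift_funpow)
  with Suc[folded y_def] show ?case
    unfolding add_Suc S_Suc_0[OF assms] S_Suc_1[OF assms] y_def[symmetric]
    by (simp add: S_Suc) (simp add: field_simps)
qed

text \<open>The factor with index \<open>k\<close> has determinant
  \<open>cc x (k - 1) / cc x k\<close>, so the product telescopes.\<close>

lemma det_S: "S_entry x z n 0 0 * S_entry x z n 1 1 - S_entry x z n 0 1 * S_entry x z n 1 0 = of_real (cc x 0 / cc x n)"
proof (induction n)
  case (Suc n)
  let ?d = "S_entry x z n 0 0 * S_entry x z n 1 1 - S_entry x z n 0 1 * S_entry x z n 1 0"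
  have "S_entry x z (Suc n) 0 0 * S_entry x z (Suc n) 1 1 - S_entry x z (Suc n) 0 1 * S_entry x z (Suc n) 1 0 =
      of_real (cc x n) * ?d / of_real (cc x (Suc n))"
    by (simp add: S_Suc field_simps)
  then show ?case unfolding Suc by simp
qed simp

lemma mat_norm_S_add:
  "mat_norm (S_path x z (n + k)) \<le> mat_norm (S_path ((seq_shift ^^ k) x) z n) * mat_norm (S_path x z k)"
proof -
  define y where "y = (seq_shift ^^ k) x"
  have col: "cmod (S_entry x z (n + k) 0 j) + cmod (S_entry x z (n + k) 1 j)
      \<le> mat_norm (S_path y z n) * (cmod (S_entry x z k 0 j) + cmod (S_entry x z k 1 j))" if "j < 2" for j
  proof -
    have "cmod (S_entry x z (n + k) 0 j) + cmod (S_entry x z (n + k) 1 j) \<le>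
       (cmod (S_entry y z n 0 0) * cmod (S_entry x z k 0 j) + cmod (S_entry y z n 0 1) * cmod (S_entry x z k 1 j)) +
       (cmod (S_entry y z n 1 0) * cmod (S_entry x z k 0 j) + cmod (S_entry y z n 1 1) * cmod (S_entry x z k 1 j))"
      unfolding S_add[OF that, THEN conjunct1] S_add[OF that, THEN conjunct2] y_def
      by (intro add_mono norm_triangle_le) (simp_all add: norm_mult)
    also have "\<dots> = (cmod (S_entry y z n 0 0) + cmod (S_entry y z n 1 0)) * cmod (S_entry x z k 0 j)
        + (cmod (S_entry y z n 0 1) + cmod (S_entry y z n 1 1)) * cmod (S_entry x z k 1 j)" by (simp add: algebra_simps)
    also have "\<dots> \<le> mat_norm (S_path y z n) * cmod (S_entry x z k 0 j) + mat_norm (S_path y z n) * cmod (S_entry x z k 1 j)"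
      by (intro add_mono mult_right_mono) (auto simp: mat_norm_S)
    finally show ?thesis by (simp add: algebra_simps)
  qed
  have nn: "mat_norm (S_path y z n) \<ge> 0" by (auto simp: mat_norm_S le_max_iff_disj)
  have "cmod (S_entry x z k 0 j) + cmod (S_entry x z k 1 j) \<le> mat_norm (S_path x z k)" if "j < 2" for j
    using that by (auto simp: mat_norm_S less_2_cases_iff)
  from col order_trans[OF col mult_left_mono[OF this nn]]
  have "cmod (S_entry x z (n + k) 0 j) + cmod (S_entry x z (n + k) 1 j) \<le> mat_norm (S_path y z n) * mat_norm (S_path x z k)"
    if "j < 2" for j using that by blast
  from this[of 0] this[of 1] show ?thesis
    unfolding mat_norm_S[of x z "n + k"] y_def by simp
qed

text \<open>The determinant is at most the product of the two column sums. After taking logarithms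
  the lower bound has mean zero by stationarity; it yields half of the integrability of the log-norm
  and the nonnegativity of its mean.\<close>

lemma mat_norm_S_lower: "cc x 0 / cc x n \<le> (mat_norm (S_path x z n))\<^sup>2"
proof -
  let ?N = "mat_norm (S_path x z n)"
  have "cc x 0 / cc x n = cmod (S_entry x z n 0 0 * S_entry x z n 1 1 - S_entry x z n 0 1 * S_entry x z n 1 0)"
    unfolding det_S norm_of_real by simp
  also have "\<dots> \<le> cmod (S_entry x z n 0 0) * cmod (S_entry x z n 1 1) + cmod (S_entry x z n 0 1) * cmod (S_entry x z n 1 0)"
    by (rule order_trans[OF norm_triangle_ineq4]) (simp add: norm_mult)
  also have "\<dots> \<le> (cmod (S_entry x z n 0 0) + cmod (S_entry x z n 1 0)) * (cmod (S_entry x z n 0 1) + cmod (S_entry x z n 1 1))"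
    by (simp add: algebra_simps)
  also have "\<dots> \<le> ?N * ?N" by (rule mult_mono) (auto simp: mat_norm_S le_max_iff_disj)
  finally show ?thesis by (simp add: power2_eq_square)
qed

lemma mat_norm_S_pos: "mat_norm (S_path x z n) > 0"
proof -
  have "(mat_norm (S_path x z n))\<^sup>2 > 0"
    by (rule less_le_trans[OF _ mat_norm_S_lower]) simp
  moreover have "mat_norm (S_path x z n) \<ge> 0" by (auto simp: mat_norm_S le_max_iff_disj)
  ultimately show ?thesis by (cases "mat_norm (S_path x z n) = 0") auto
qed

lemma ln_mat_norm_S_lower: "(log_c (x 0) - log_c (x n)) / 2 \<le> ln (mat_norm (S_path x z n))"
proof -
  have "ln (cc x 0 / cc x n) \<le> ln ((mat_norm (S_path x z n))\<^sup>2)"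
    using mat_norm_S_lower[of x n z] by (intro ln_mono) (auto simp: mat_norm_S_pos)
  then show ?thesis by (simp add: ln_div ln_realpow mat_norm_S_pos)
qed

subsection \<open>Dependence on the spectral parameter\<close>

text \<open>The largest column sum of the first transfer matrix; at
  \<open>(seq_shift ^^ k) x\<close> it is that of the factor with index
  \<open>Suc k\<close>.\<close>

definition A_norm :: "complex \<Rightarrow> (nat \<Rightarrow> env) \<Rightarrow> real" where
  "A_norm z x = max (cmod (of_real (pot (x 1)) - z) / cc x 1 + 1) (cc x 0 / cc x 1)"

lemma A_norm_ge_1: "A_norm z x \<ge> 1"
  by (simp add: A_norm_def le_max_iff_disj)

lemma A_norm_mono:
  assumes "dist z w \<le> \<rho>"
  shows "A_norm w x \<le> A_norm z x + \<rho> / cc x 1"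
proof -
  have "cmod (of_real (pot (x 1)) - w) \<le> cmod (of_real (pot (x 1)) - z) + \<rho>"
    using assms norm_triangle_ineq[of "of_real (pot (x 1)) - z" "z - w"] by (simp add: dist_norm)
  then have "cmod (of_real (pot (x 1)) - w) / cc x 1 \<le> cmod (of_real (pot (x 1)) - z) / cc x 1 + \<rho> / cc x 1"
    by (simp add: add_divide_distrib[symmetric] divide_right_mono)
  moreover have "0 \<le> \<rho> / cc x 1" using order_trans[OF zero_le_dist assms] by simp
  ultimately show ?thesis
    using max.cobounded1[of "cmod (of_real (pot (x 1)) - z) / cc x 1 + 1" "cc x 0 / cc x 1"]
      max.cobounded2[of "cc x 0 / cc x 1" "cmod (of_real (pot (x 1)) - z) / cc x 1 + 1"]
    unfolding A_norm_def by (intro max.boundedI) linarith+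
qed

lemma transfer_step_le:
  "cmod (((of_real (pot (x (Suc n))) - z) * a - of_real (cc x n) * b) / of_real (cc x (Suc n))) + cmod a
    \<le> A_norm z ((seq_shift ^^ n) x) * (cmod a + cmod b)"
proof -
  define y where "y = (seq_shift ^^ n) x"
  have y: "x n = y 0" "x (Suc n) = y 1" by (simp_all add: y_def seq_shift_funpow)
  have "cmod (((of_real (pot (y 1)) - z) * a - of_real (cc y 0) * b) / of_real (cc y 1)) + cmod a
      \<le> (cmod (of_real (pot (y 1)) - z) * cmod a + cc y 0 * cmod b) / cc y 1 + cmod a"
    unfolding norm_divide norm_of_real abs_exp_cancel
    by (intro add_right_mono divide_right_mono order_trans[OF norm_triangle_ineq4]) (simp_all add: norm_mult)
  also have "\<dots> = (cmod (of_real (pot (y 1)) - z) / cc y 1 + 1) * cmod a + cc y 0 / cc y 1 * cmod b"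
    by (simp add: field_simps)
  also have "\<dots> \<le> A_norm z y * cmod a + A_norm z y * cmod b"
    by (intro add_mono mult_right_mono) (simp_all add: A_norm_def)
  finally show ?thesis by (simp add: y_def[symmetric] y distrib_left)
qed

lemma col_S_le:
  assumes "j < 2"
  shows "cmod (S_entry x z n 0 j) + cmod (S_entry x z n 1 j) \<le> (\<Prod>k<n. A_norm z ((seq_shift ^^ k) x))"
proof (induction n)
  case 0
  then show ?case using assms by (auto simp: less_2_cases_iff)
next
  case (Suc n)
  have "cmod (S_entry x z (Suc n) 0 j) + cmod (S_entry x z (Suc n) 1 j)
     \<le> A_norm z ((seq_shift ^^ n) x) * (cmod (S_entry x z n 0 j) + cmod (S_entry x z n 1 j))"
    unfolding S_Suc_0[OF assms] S_Suc_1[OF assms] by (rule transfer_step_le)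
  also have "\<dots> \<le> A_norm z ((seq_shift ^^ n) x) * (\<Prod>k<n. A_norm z ((seq_shift ^^ k) x))"
    by (rule mult_left_mono[OF Suc]) (use A_norm_ge_1[of z "(seq_shift ^^ n) x"] in linarith)
  finally show ?case by (simp only: prod.lessThan_Suc mult.commute)
qed

lemma mat_norm_S_le_prod: "mat_norm (S_path x z n) \<le> (\<Prod>k<n. A_norm z ((seq_shift ^^ k) x))"
  using col_S_le[of 0 x z n] col_S_le[of 1 x z n] by (simp add: mat_norm_S)

text \<open>The difference \<open>D\<close> of the two products obeys
  \<open>D' = A(w) D + (A(w) - A(z)) S(z)\<close>, and \<open>A(w) - A(z)\<close> has norm at most
  \<open>\<rho> / cc x (Suc n)\<close>. The enlarged product of norms minus the original one
  satisfies the matching scalar recursion with equality, hence dominates.\<close>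

lemma mat_norm_S_perturb:
  assumes w: "dist z w \<le> \<rho>"
  shows "mat_norm (S_path x w n) \<le> mat_norm (S_path x z n)
    + (\<Prod>k<n. A_norm z ((seq_shift ^^ k) x) + \<rho> / cc x (Suc k)) - (\<Prod>k<n. A_norm z ((seq_shift ^^ k) x))"
proof -
  define a where "a k = A_norm z ((seq_shift ^^ k) x)" for k
  define P where "P n = (\<Prod>k<n. a k + \<rho> / cc x (Suc k))" for n
  define Q where "Q n = (\<Prod>k<n. a k)" for n
  have \<rho>: "\<rho> \<ge> 0" using order_trans[OF zero_le_dist w] .
  have a1: "a k \<ge> 1" for k by (simp add: a_def A_norm_ge_1)
  define D where "D n i j = S_entry x w n i j - S_entry x z n i j" for n i j
  have D: "cmod (D n 0 j) + cmod (D n 1 j) \<le> P n - Q n" if j: "j < 2" for j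
  proof (induction n)
    case 0
    then show ?case using j by (simp add: D_def P_def Q_def)
  next
    case (Suc n)
    have D0: "D (Suc n) 0 j = ((of_real (pot (x (Suc n))) - w) * D n 0 j - of_real (cc x n) * D n 1 j) / of_real (cc x (Suc n))
       + (z - w) * S_entry x z n 0 j / of_real (cc x (Suc n))"
      unfolding D_def S_Suc_0[OF j] by (simp add: add_divide_distrib[symmetric] diff_divide_distrib[symmetric]) (simp add: algebra_simps)
    have D1: "D (Suc n) 1 j = D n 0 j" by (simp only: D_def S_Suc_1[OF j])
    have aw: "A_norm w ((seq_shift ^^ n) x) \<le> a n + \<rho> / cc x (Suc n)"
      using A_norm_mono[OF w, of "(seq_shift ^^ n) x"] by (simp add: a_def seq_shift_funpow)
    have "cmod (D (Suc n) 0 j) + cmod (D (Suc n) 1 j) \<le>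
       (cmod (((of_real (pot (x (Suc n))) - w) * D n 0 j - of_real (cc x n) * D n 1 j) / of_real (cc x (Suc n))) + cmod (D n 0 j))
       + cmod ((z - w) * S_entry x z n 0 j / of_real (cc x (Suc n)))"
      unfolding D0 D1 using norm_triangle_ineq by (simp add: algebra_simps)
    also have "\<dots> \<le> A_norm w ((seq_shift ^^ n) x) * (cmod (D n 0 j) + cmod (D n 1 j)) + \<rho> / cc x (Suc n) * Q n"
    proof (rule add_mono[OF transfer_step_le])
      have "cmod (S_entry x z n 0 j) \<le> Q n" using col_S_le[OF j, of x z n] unfolding Q_def a_def
        using norm_ge_zero[of "S_entry x z n 1 j"] by linarith
      moreover have "cmod (z - w) \<le> \<rho>" using w by (simp add: dist_norm)
      ultimately have "cmod (z - w) * cmod (S_entry x z n 0 j) \<le> \<rho> * Q n" using \<rho> by (intro mult_mono) auto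
      then show "cmod ((z - w) * S_entry x z n 0 j / of_real (cc x (Suc n))) \<le> \<rho> / cc x (Suc n) * Q n"
        by (simp add: norm_mult norm_divide divide_right_mono)
    qed
    also have "\<dots> \<le> (a n + \<rho> / cc x (Suc n)) * (P n - Q n) + \<rho> / cc x (Suc n) * Q n"
      by (intro add_right_mono mult_mono[OF aw Suc]) (use \<rho> a1[of n] in \<open>auto intro!: add_nonneg_nonneg\<close>)
    also have "\<dots> = P (Suc n) - Q (Suc n)" by (simp add: P_def Q_def algebra_simps)
    finally show ?case .
  qed
  have col: "cmod (S_entry x w n 0 j) + cmod (S_entry x w n 1 j) \<le> (cmod (S_entry x z n 0 j) + cmod (S_entry x z n 1 j)) + (P n - Q n)"
    if j: "j < 2" for j
  proof -
    have "cmod (S_entry x w n i j) \<le> cmod (S_entry x z n i j) + cmod (D n i j)" for i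
      using norm_triangle_ineq[of "S_entry x z n i j" "D n i j"] by (simp add: D_def)
    from this[of 0] this[of 1] D[OF j] show ?thesis by linarith
  qed
  have "mat_norm (S_path x w n) \<le> mat_norm (S_path x z n) + (P n - Q n)"
    using col[of 0] col[of 1] unfolding mat_norm_S by linarith
  then show ?thesis by (simp add: P_def Q_def a_def)
qed

subsection \<open>Non-real spectral parameters\<close>

text \<open>
  For \<open>a \<noteq> 0\<close> and \<open>Im z > 0\<close> the condition says \<open>Im (- 1 / a) \<ge> Im z / c\<close>; it is the property
  of the diagonal Green functions \<open>c * G(z)\<close> that the Riccati recursion preserves.
\<close>

definition herglotz :: "complex \<Rightarrow> real \<Rightarrow> complex \<Rightarrow> bool" where
  "herglotz z c a \<longleftrightarrow> (Im z)\<^sup>2 * (cmod a)\<^sup>2 \<le> c * (Im z * Im a)"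

lemma herglotz_0 [simp]: "herglotz z c 0"
  by (simp add: herglotz_def)

lemma herglotz_Im:
  assumes "herglotz z c a" "c > 0"
  shows "Im z * Im a \<ge> 0"
proof -
  have "0 \<le> (Im z)\<^sup>2 * (cmod a)\<^sup>2" by simp
  also have "\<dots> \<le> c * (Im z * Im a)" using assms by (simp add: herglotz_def)
  finally show ?thesis using assms(2) by (simp add: zero_le_mult_iff)
qed

lemma herglotz_cmod:
  assumes "herglotz z c a" "c > 0" "Im z \<noteq> 0"
  shows "cmod a \<le> c / \<bar>Im z\<bar>"
proof (cases "a = 0")
  case False
  have "\<bar>Im z\<bar>\<^sup>2 * (cmod a)\<^sup>2 \<le> c * (Im z * Im a)" using assms by (simp add: herglotz_def)
  also have "\<dots> \<le> c * (\<bar>Im z\<bar> * cmod a)"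
    using assms(2) abs_Im_le_cmod[of a]
    by (intro mult_left_mono) (auto intro: order_trans[OF abs_ge_self] simp: abs_mult mult_left_mono)
  finally have "(\<bar>Im z\<bar> * cmod a) * (\<bar>Im z\<bar> * cmod a) \<le> c * (\<bar>Im z\<bar> * cmod a)"
    by (simp add: power2_eq_square algebra_simps)
  then have "\<bar>Im z\<bar> * cmod a \<le> c" by (rule mult_right_le_imp_le) (use False assms in auto)
  then show ?thesis using assms by (simp add: field_simps)
qed (use assms in auto)

text \<open>\<open>Im a\<close> never has the sign opposite to that of \<open>Im z\<close>, so
  subtracting \<open>c * a\<close> from \<open>q - z\<close> can only move the denominator away from
  the real axis. Inversion turns this into the condition for the next ratio.\<close>

lemma herglotz_step:
  assumes a: "herglotz z c a" and c: "c > 0" and d: "d > 0" and z: "Im z \<noteq> 0"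
  shows "of_real q - z - of_real c * a \<noteq> 0"
    and "\<bar>Im z\<bar> \<le> cmod (of_real q - z - of_real c * a)"
    and "herglotz z d (of_real d / (of_real q - z - of_real c * a))"
proof -
  define D where "D = of_real q - z - of_real c * a"
  have ImD: "(Im z)\<^sup>2 \<le> - (Im z * Im D)"
    using mult_nonneg_nonneg[OF less_imp_le[OF c] herglotz_Im[OF a c]]
    by (simp add: D_def power2_eq_square algebra_simps)
  have D: "D \<noteq> 0" using ImD z by auto
  then show "of_real q - z - of_real c * a \<noteq> 0" by (simp add: D_def)
  have "\<bar>Im z\<bar> * \<bar>Im z\<bar> \<le> \<bar>Im z\<bar> * \<bar>Im D\<bar>"
    using ImD abs_ge_minus_self[of "Im z * Im D"] by (simp add: abs_mult[symmetric] power2_eq_square)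
  then have "\<bar>Im z\<bar> \<le> \<bar>Im D\<bar>" by (rule mult_left_le_imp_le) (use z in simp)
  then show "\<bar>Im z\<bar> \<le> cmod (of_real q - z - of_real c * a)"
    using abs_Im_le_cmod[of D] by (simp add: D_def)
  have "(Im z)\<^sup>2 * (d\<^sup>2 / (cmod D)\<^sup>2) \<le> - (Im z * Im D) * (d\<^sup>2 / (cmod D)\<^sup>2)"
    by (rule mult_right_mono[OF ImD]) simp
  also have "\<dots> = d * (Im z * Im (of_real d / D))"
    by (simp add: Im_divide cmod_power2) (simp add: power2_eq_square)
  finally show "herglotz z d (of_real d / (of_real q - z - of_real c * a))"
    unfolding D_def[symmetric] herglotz_def by (simp add: norm_divide power_divide)
qed

text \<open>If \<open>a\<close> is small, the bound on \<open>b\<close> makes the product at most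
  1/2 in modulus. Otherwise write the expression as \<open>a * (1 / a - r * b)\<close>: the
  imaginary parts of \<open>1 / a\<close> and \<open>- r * b\<close> do not have opposite signs, so
  they cannot cancel, and \<open>a\<close> is bounded below.\<close>

lemma herglotz_product:
  assumes a: "herglotz z c a" and b: "herglotz z d b" and c: "c > 0" and d: "d > 0"
    and r: "r > 0" and z: "Im z \<noteq> 0"
  shows "min (1 / 2) ((Im z)\<^sup>2 / (2 * r * c * d)) \<le> cmod (1 - of_real r * a * b)"
proof (cases "r * cmod a * d / \<bar>Im z\<bar> \<le> 1 / 2")
  case True
  have "cmod (of_real r * a * b) = r * cmod a * cmod b" using r by (simp add: norm_mult)
  also have "\<dots> \<le> r * cmod a * (d / \<bar>Im z\<bar>)"
    by (rule mult_left_mono[OF herglotz_cmod[OF b d z]]) (use r in simp)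
  finally have "cmod (of_real r * a * b) \<le> 1 / 2"
    using True unfolding times_divide_eq_right by linarith
  then have "1 / 2 \<le> cmod (1 - of_real r * a * b)"
    using norm_triangle_ineq2[of 1 "of_real r * a * b"] by simp
  then show ?thesis by simp
next
  case False
  then have a_large: "\<bar>Im z\<bar> / (2 * r * d) < cmod a" using r d z by (simp add: field_simps)
  moreover have "0 \<le> \<bar>Im z\<bar> / (2 * r * d)" using r d by simp
  ultimately have a0: "a \<noteq> 0" by auto
  have Im_inv: "(Im z)\<^sup>2 / c \<le> - (Im z * Im (inverse a))"
  proof -
    have "(Im z)\<^sup>2 \<le> c * (Im z * Im a) / (cmod a)\<^sup>2"
      using a a0 by (simp add: herglotz_def pos_le_divide_eq)
    then have "(Im z)\<^sup>2 \<le> c * (Im z * Im a / (cmod a)\<^sup>2)" by simp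
    then show ?thesis using c by (simp add: pos_divide_le_eq cmod_power2 mult.commute)
  qed
  have "(Im z)\<^sup>2 / c \<le> - (Im z * Im (inverse a - of_real r * b))"
    using Im_inv mult_nonneg_nonneg[OF less_imp_le[OF r] herglotz_Im[OF b d]] by (simp add: algebra_simps)
  also have "\<dots> \<le> \<bar>Im z\<bar> * cmod (inverse a - of_real r * b)"
    using abs_Im_le_cmod[of "inverse a - of_real r * b"]
    by (intro order_trans[OF abs_ge_minus_self]) (simp only: abs_mult mult_left_mono abs_ge_zero)
  finally have "\<bar>Im z\<bar> * (\<bar>Im z\<bar> / c) \<le> \<bar>Im z\<bar> * cmod (inverse a - of_real r * b)"
    by (simp add: power2_eq_square)
  then have "\<bar>Im z\<bar> / c \<le> cmod (inverse a - of_real r * b)"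
    by (rule mult_left_le_imp_le) (use z in simp)
  then have "\<bar>Im z\<bar> / (2 * r * d) * (\<bar>Im z\<bar> / c) \<le> cmod a * cmod (inverse a - of_real r * b)"
    using a_large c r d by (intro mult_mono) auto
  also have "\<dots> = cmod (1 - of_real r * a * b)"
    using a0 by (simp add: norm_mult[symmetric] algebra_simps)
  finally show ?thesis by (simp add: power2_eq_square min_le_iff_disj mult_ac)
qed

text \<open>The ratio \<open>a\<close> of the lower to the upper entry of a column evolves by
  \<open>a' = c' / (q - z - c * a)\<close>, the map treated in \<open>herglotz_step\<close>.\<close>

lemma riccati_step:
  assumes z: "Im z \<noteq> 0" and j: "j < 2"
    and n: "S_entry x z n 0 j \<noteq> 0" "herglotz z (cc x n) (S_entry x z n 1 j / S_entry x z n 0 j)"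
  shows "S_entry x z (Suc n) 0 j \<noteq> 0" "herglotz z (cc x (Suc n)) (S_entry x z (Suc n) 1 j / S_entry x z (Suc n) 0 j)"
proof -
  let ?D = "of_real (pot (x (Suc n))) - z - of_real (cc x n) * (S_entry x z n 1 j / S_entry x z n 0 j)"
  have eq: "S_entry x z (Suc n) 0 j = S_entry x z n 0 j * ?D / of_real (cc x (Suc n))"
    using n(1) by (simp add: S_Suc_0[OF j] field_simps)
  note step = herglotz_step[OF n(2) exp_gt_zero exp_gt_zero z, where q = "pot (x (Suc n))"]
  show "S_entry x z (Suc n) 0 j \<noteq> 0" using eq n(1) step(1) by simp
  have "S_entry x z (Suc n) 1 j / S_entry x z (Suc n) 0 j = of_real (cc x (Suc n)) / ?D"
    unfolding eq S_Suc_1[OF j] using n(1) step(1) by simp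
  then show "herglotz z (cc x (Suc n)) (S_entry x z (Suc n) 1 j / S_entry x z (Suc n) 0 j)"
    using step(3)[of "log_c (x (Suc n))"] by simp
qed

lemma riccati_col0:
  assumes z: "Im z \<noteq> 0"
  shows "S_entry x z n 0 0 \<noteq> 0 \<and> herglotz z (cc x n) (S_entry x z n 1 0 / S_entry x z n 0 0)"
proof (induction n)
  case (Suc n)
  then show ?case using riccati_step[OF z, of 0 x n] by simp
qed simp

text \<open>The second column starts as (0, 1), where the ratio has denominator zero. After one step
  the ratio is 0, so the induction starts at index 1.\<close>

lemma riccati_col1:
  assumes z: "Im z \<noteq> 0"
  shows "S_entry x z (Suc n) 0 1 \<noteq> 0 \<and> herglotz z (cc x (Suc n)) (S_entry x z (Suc n) 1 1 / S_entry x z (Suc n) 0 1)"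
proof (induction n)
  case 0
  then show ?case by (simp add: S_Suc)
next
  case (Suc n)
  then show ?case using riccati_step[OF z, of 1 x "Suc n"] by simp
qed

text \<open>Ratios along the first row obey the same recursion run from the other end: split off the
  first factor and apply the induction hypothesis to the shifted path.\<close>

lemma riccati_row0:
  assumes z: "Im z \<noteq> 0"
  shows "herglotz z (cc x 0) (- (S_entry x z n 0 1 / S_entry x z n 0 0))"
proof (induction n arbitrary: x)
  case (Suc n)
  define y where "y = (seq_shift ^^ 1) x"
  define D where "D = of_real (pot (x 1)) - z - of_real (cc y 0) * (- (S_entry y z n 0 1 / S_entry y z n 0 0))"
  have y0: "y 0 = x 1" by (simp add: y_def seq_shift_def)
  have S0: "S_entry y z n 0 0 \<noteq> 0" using riccati_col0[OF z] by blast
  note step = herglotz_step[OF Suc[of y] exp_gt_zero exp_gt_zero z, where q = "pot (x 1)", folded D_def]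
  have split: "S_entry x z (Suc n) 0 j = S_entry y z n 0 0 * S_entry x z 1 0 j + S_entry y z n 0 1 * S_entry x z 1 1 j" if "j < 2" for j
    using S_add[OF that, of x z n 1] by (simp add: y_def)
  have first: "S_entry x z 1 0 0 = (of_real (pot (x 1)) - z) / of_real (cc x 1)" "S_entry x z 1 1 0 = 1"
    "S_entry x z 1 0 1 = - of_real (cc x 0) / of_real (cc x 1)" "S_entry x z 1 1 1 = 0" by (simp_all add: S_Suc)
  have "S_entry x z (Suc n) 0 0 = S_entry y z n 0 0 * D / of_real (cc x 1)"
    unfolding split[OF pos2] first D_def y0 using S0 by (simp add: field_simps)
  moreover have "S_entry x z (Suc n) 0 1 = - S_entry y z n 0 0 * of_real (cc x 0) / of_real (cc x 1)"
    using split[of 1] first by simp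
  ultimately have "- (S_entry x z (Suc n) 0 1 / S_entry x z (Suc n) 0 0) = of_real (cc x 0) / D"
    using S0 step(1) by simp
  then show ?case using step(3)[of "log_c (x 0)"] by simp
qed simp

text \<open>By the cocycle relation the entry is the product of the two block entries and
  \<open>1 - a * b\<close>, with \<open>a\<close> a column ratio of the first block and
  \<open>b\<close> a negated row ratio of the second. Both are Herglotz with constant
  \<open>cc x k\<close>.\<close>

lemma S00_superadditive:
  assumes z: "Im z \<noteq> 0"
  shows "cmod (S_entry ((seq_shift ^^ k) x) z n 0 0) * cmod (S_entry x z k 0 0) * min (1 / 2) ((Im z)\<^sup>2 / (2 * (cc x k)\<^sup>2))
    \<le> cmod (S_entry x z (n + k) 0 0)"
proof -
  define y where "y = (seq_shift ^^ k) x"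
  have y0: "y 0 = x k" by (simp add: y_def seq_shift_funpow)
  define a where "a = S_entry x z k 1 0 / S_entry x z k 0 0"
  define b where "b = - (S_entry y z n 0 1 / S_entry y z n 0 0)"
  have "S_entry x z k 0 0 \<noteq> 0" "S_entry y z n 0 0 \<noteq> 0" using riccati_col0[OF z] by blast+
  then have "S_entry x z (n + k) 0 0 = S_entry y z n 0 0 * S_entry x z k 0 0 * (1 - of_real 1 * a * b)"
    using S_add[of 0 x z n k] by (simp add: y_def[symmetric] a_def b_def field_simps)
  moreover have "min (1 / 2) ((Im z)\<^sup>2 / (2 * 1 * cc x k * cc x k)) \<le> cmod (1 - of_real 1 * a * b)"
  proof (rule herglotz_product[OF _ _ _ _ _ z])
    show "herglotz z (cc x k) a" using riccati_col0[OF z] by (simp add: a_def)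
    show "herglotz z (cc x k) b" using riccati_row0[OF z, of y n] by (simp add: b_def y0)
  qed simp_all
  ultimately show ?thesis
    by (simp add: norm_mult y_def[symmetric] power2_eq_square mult.assoc mult_left_mono)
qed

text \<open>This is the right side of the eigenvalue equation with \<open>d2\<close> factored out.
  Expressing the last entry through \<open>S01\<close>, and \<open>S01\<close> through
  \<open>S00\<close>, gives \<open>S00 * (1 - r * a * b)\<close>; \<open>n > 0\<close> keeps
  \<open>S01\<close> nonzero.\<close>

lemma S00_S11_lower:
  assumes z: "Im z \<noteq> 0" and n: "n > 0" and r: "r > 0"
  shows "cmod (S_entry x z n 0 0) * min (1 / 2) ((Im z)\<^sup>2 / (2 * r * cc x 0 * cc x n))
    \<le> cmod (S_entry x z n 0 0 + of_real r * S_entry x z n 1 1)"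
proof -
  obtain m where m: "n = Suc m" using n by (cases n) auto
  define a where "a = - (S_entry x z n 0 1 / S_entry x z n 0 0)"
  define b where "b = S_entry x z n 1 1 / S_entry x z n 0 1"
  have "S_entry x z n 0 0 \<noteq> 0" "S_entry x z n 0 1 \<noteq> 0"
    using riccati_col0[OF z] riccati_col1[OF z] unfolding m by blast+
  then have "S_entry x z n 0 0 + of_real r * S_entry x z n 1 1 = S_entry x z n 0 0 * (1 - of_real r * a * b)"
    by (simp add: a_def b_def field_simps)
  moreover have "min (1 / 2) ((Im z)\<^sup>2 / (2 * r * cc x 0 * cc x n)) \<le> cmod (1 - of_real r * a * b)"
  proof (rule herglotz_product[OF _ _ _ _ r z])
    show "herglotz z (cc x 0) a" using riccati_row0[OF z] by (simp add: a_def)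
    show "herglotz z (cc x n) b" using riccati_col1[OF z] unfolding b_def m by blast
  qed simp_all
  ultimately show ?thesis by (simp add: norm_mult mult_left_mono)
qed

text \<open>The Herglotz bounds on the row and column ratios control the other three entries by
  \<open>S00\<close>. Growth of the norm thereby becomes growth of a single entry.\<close>

lemma mat_norm_S_le_S00:
  assumes z: "Im z \<noteq> 0" and n: "n > 0"
  shows "mat_norm (S_path x z n) \<le> (1 + cc x n / \<bar>Im z\<bar>) * (1 + cc x 0 / \<bar>Im z\<bar>) * cmod (S_entry x z n 0 0)"
proof -
  obtain m where m: "n = Suc m" using n by (cases n) auto
  have nz: "S_entry x z n 0 0 \<noteq> 0" "S_entry x z n 0 1 \<noteq> 0"
    using riccati_col0[OF z] riccati_col1[OF z] unfolding m by blast+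
  define p where "p = cc x n / \<bar>Im z\<bar>"
  define s where "s = cc x 0 / \<bar>Im z\<bar>"
  define u where "u = cmod (S_entry x z n 0 0)"
  have ps: "p \<ge> 0" "s \<ge> 0" "u \<ge> 0" by (simp_all add: p_def s_def u_def)
  have "cmod (S_entry x z n 1 0 / S_entry x z n 0 0) \<le> p" unfolding p_def
    using riccati_col0[OF z] by (intro herglotz_cmod[OF _ _ z]) auto
  then have 1: "cmod (S_entry x z n 1 0) \<le> p * u" using nz by (simp add: norm_divide u_def pos_divide_le_eq)
  have "cmod (- (S_entry x z n 0 1 / S_entry x z n 0 0)) \<le> s" unfolding s_def
    using riccati_row0[OF z] by (intro herglotz_cmod[OF _ _ z]) auto
  then have 2: "cmod (S_entry x z n 0 1) \<le> s * u" using nz by (simp add: norm_divide u_def pos_divide_le_eq)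
  have "cmod (S_entry x z n 1 1 / S_entry x z n 0 1) \<le> p" unfolding p_def
    using riccati_col1[OF z] m by (intro herglotz_cmod[OF _ _ z]) auto
  then have "cmod (S_entry x z n 1 1) \<le> p * cmod (S_entry x z n 0 1)" using nz by (simp add: norm_divide pos_divide_le_eq)
  also have "\<dots> \<le> p * (s * u)" by (rule mult_left_mono[OF 2 ps(1)])
  finally have 3: "cmod (S_entry x z n 1 1) \<le> p * (s * u)" .
  have "0 \<le> p * u" "0 \<le> s * u" "0 \<le> p * (s * u)" using ps by simp_all
  moreover have "(1 + p) * (1 + s) * u = u + p * u + s * u + p * (s * u)" by (simp add: algebra_simps)
  ultimately have "mat_norm (S_path x z n) \<le> (1 + p) * (1 + s) * u"
    unfolding mat_norm_S u_def[symmetric] using 1 2 3 ps by (intro max.boundedI) linarith+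
  then show ?thesis by (simp add: p_def s_def u_def)
qed

section \<open>The upper left entry as a polynomial with real zeros\<close>

lemma S00_is_poly:
  "\<exists>p r. degree p \<le> n \<and> degree r \<le> n \<and> (\<forall>z. poly p z = S_entry x z n 0 0) \<and> (\<forall>z. poly r z = S_entry x z n 1 0)"
proof (induction n)
  case 0
  have "degree (1::complex poly) \<le> 0 \<and> degree (0::complex poly) \<le> 0 \<and>
    (\<forall>z. poly 1 z = S_entry x z 0 0 0) \<and> (\<forall>z. poly 0 z = S_entry x z 0 1 0)" by simp
  then show ?case by blast
next
  case (Suc n)
  then obtain p r where pr: "degree p \<le> n" "degree r \<le> n"
    "\<And>z. poly p z = S_entry x z n 0 0" "\<And>z. poly r z = S_entry x z n 1 0" by blast
  define p' where "p' = Polynomial.smult (1 / of_real (cc x (Suc n)))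
     ([:of_real (pot (x (Suc n))), -1:] * p - Polynomial.smult (of_real (cc x n)) r)"
  have "degree ([:of_real (pot (x (Suc n))), -1:] * p) \<le> Suc n"
    by (rule order_trans[OF degree_mult_le]) (use pr in simp)
  then have "degree p' \<le> Suc n" unfolding p'_def
    by (intro order_trans[OF degree_smult_le] degree_diff_le) (use pr in \<open>auto intro: order_trans[OF degree_smult_le]\<close>)
  moreover have "poly p' z = S_entry x z (Suc n) 0 0" for z
    by (simp add: p'_def S_Suc pr(3,4)) (simp add: field_simps)
  moreover have "poly p z = S_entry x z (Suc n) 1 0" for z by (simp add: S_Suc pr(3))
  ultimately show ?case using pr(1) le_SucI by blast
qed

text \<open>A real zero has distance at least \<open>\<bar>Im z\<bar>\<close> from \<open>z\<close>,
  so the move to \<open>w\<close> shrinks each linear factor at most by the ratio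
  \<open>1 - \<rho>\<close>. The induction splits off one factor at a time.\<close>

lemma real_rooted_poly_comparison:
  fixes p :: "complex poly"
  assumes roots: "\<And>a. poly p a = 0 \<Longrightarrow> Im a = 0"
    and n: "degree p \<le> n" and \<rho>: "0 \<le> \<rho>" "\<rho> \<le> 1" and w: "dist z w \<le> \<rho> * \<bar>Im z\<bar>"
  shows "(1 - \<rho>) ^ n * cmod (poly p z) \<le> cmod (poly p w)"
  using roots n
proof (induction n arbitrary: p)
  case 0
  then show ?case by (auto elim: degree_eq_zeroE)
next
  case (Suc n)
  show ?case
  proof (cases "degree p = 0")
    case True
    then obtain c where "p = [:c:]" by (rule degree_eq_zeroE)
    moreover have "(1 - \<rho>) ^ Suc n * cmod c \<le> 1 * cmod c"
      using \<rho> by (intro mult_right_mono power_le_one) auto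
    ultimately show ?thesis by simp
  next
    case False
    then obtain a where a: "poly p a = 0"
      using fundamental_theorem_of_algebra[of p] constant_degree[of p] by auto
    then obtain r where p: "p = [:- a, 1:] * r" by (auto simp: poly_eq_0_iff_dvd)
    have r0: "r \<noteq> 0" using p False by auto
    have "degree p = Suc (degree r)" unfolding p using r0 by (subst degree_mult_eq) auto
    then have IH: "(1 - \<rho>) ^ n * cmod (poly r z) \<le> cmod (poly r w)"
      using Suc.prems by (intro Suc.IH) (auto simp: p)
    have "\<bar>Im z\<bar> \<le> cmod (z - a)" using abs_Im_le_cmod[of "z - a"] Suc.prems(1)[OF a] by simp
    then have "\<rho> * \<bar>Im z\<bar> \<le> \<rho> * cmod (z - a)" using \<rho> by (intro mult_left_mono)
    moreover have "cmod (z - a) \<le> cmod (z - w) + cmod (w - a)" using norm_triangle_ineq[of "z - w" "w - a"] by simp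
    ultimately have "(1 - \<rho>) * cmod (z - a) \<le> cmod (w - a)" using w by (simp add: dist_norm algebra_simps)
    from mult_mono[OF this IH] \<rho> have "(1 - \<rho>) * cmod (z - a) * ((1 - \<rho>) ^ n * cmod (poly r z))
        \<le> cmod (w - a) * cmod (poly r w)" by simp
    moreover have "poly [:- a, 1:] v = v - a" for v by simp
    ultimately show ?thesis by (simp only: p poly_mult norm_mult power_Suc mult_ac)
  qed
qed

text \<open>The loss does not depend on the path, so a lower bound at one \<open>z\<close> extends
  to a disc at a small exponential cost.\<close>

lemma S00_comparison:
  assumes "Im z \<noteq> 0" "0 \<le> \<rho>" "\<rho> \<le> 1" "dist z w \<le> \<rho> * \<bar>Im z\<bar>"
  shows "(1 - \<rho>) ^ n * cmod (S_entry x z n 0 0) \<le> cmod (S_entry x w n 0 0)"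
proof -
  obtain p where p: "degree p \<le> n" "\<And>z. poly p z = S_entry x z n 0 0" using S00_is_poly[of n x] by blast
  have "poly p a = 0 \<Longrightarrow> Im a = 0" for a using riccati_col0[of a x n] p(2) by auto
  from real_rooted_poly_comparison[OF this p(1) assms(2-4)] show ?thesis by (simp add: p(2))
qed

subsection \<open>Eigenvalues and transfer matrices\<close>

text \<open>\<open>\<psi>\<close> is the eigenvector indexed from 1 and continued periodically by
  one site on each side, so the corner entries act as ordinary neighbours.\<close>

lemma J_mat_row:
  assumes n: "n \<ge> 3" and v: "v \<in> carrier_vec n" and k: "1 \<le> k" "k \<le> n"
    and eig: "map_mat complex_of_real (J_mat n \<xi> \<eta> q) *\<^sub>v v = z \<cdot>\<^sub>v v"
    and \<psi>: "\<And>k. \<psi> k = (if k = 0 then v $ (n - 1) else if k = Suc n then v $ 0 else v $ (k - 1))"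
  shows "- of_real (exp (\<xi> (k - 1))) * \<psi> (k - 1) + of_real (q k) * \<psi> k - of_real (exp (\<eta> k)) * \<psi> (k + 1) = z * \<psi> k"
proof -
  have "(map_mat complex_of_real (J_mat n \<xi> \<eta> q) *\<^sub>v v) $ (k - 1)
      = (\<Sum>j<n. of_real (J_entry n \<xi> \<eta> q k (j + 1)) * v $ j)"
    using v k by (simp add: J_mat_def scalar_prod_def atLeast0LessThan)
  moreover have "(z \<cdot>\<^sub>v v) $ (k - 1) = z * \<psi> k" using v k by (simp add: \<psi>)
  ultimately have "z * \<psi> k = (\<Sum>j<n. of_real (J_entry n \<xi> \<eta> q k (j + 1)) * v $ j)" by (simp add: eig)
  also have "\<dots> = - of_real (exp (\<xi> (k - 1))) * \<psi> (k - 1) + of_real (q k) * \<psi> k - of_real (exp (\<eta> k)) * \<psi> (k + 1)"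
  proof -
    \<comment> \<open>\<open>a\<close> and \<open>b\<close> are the cyclic neighbours of column
      \<open>k - 1\<close>, counted from 0; \<open>n \<ge> 3\<close> keeps the three columns
      distinct.\<close>
    define a where "a = (if k = 1 then n - 1 else k - 2)"
    define b where "b = (if k = n then 0 else k)"
    have sub: "{a, k - 1, b} \<subseteq> {..<n}" using n k by (auto simp: a_def b_def)
    have dist: "a \<noteq> k - 1" "a \<noteq> b" "b \<noteq> k - 1" using n k by (auto simp: a_def b_def)
    have "(\<Sum>j<n. of_real (J_entry n \<xi> \<eta> q k (j + 1)) * v $ j)
        = (\<Sum>j\<in>{a, k - 1, b}. of_real (J_entry n \<xi> \<eta> q k (j + 1)) * v $ j)"
      by (rule sum.mono_neutral_right[OF _ sub])
        (use n k in \<open>auto simp: J_entry_def a_def b_def split: if_splits\<close>)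
    also have "\<dots> = of_real (J_entry n \<xi> \<eta> q k (a + 1)) * v $ a + of_real (J_entry n \<xi> \<eta> q k (k - 1 + 1)) * v $ (k - 1)
        + of_real (J_entry n \<xi> \<eta> q k (b + 1)) * v $ b"
      using dist by (simp add: add.assoc)
    also have "J_entry n \<xi> \<eta> q k (a + 1) = - exp (\<xi> (k - 1))"
    proof (cases "k = 1")
      case False
      then have "k = Suc (Suc (k - 2))" using k by simp
      then obtain m where "k = Suc (Suc m)" by blast
      then show ?thesis using n k by (auto simp: J_entry_def a_def)
    qed (use n in \<open>simp add: J_entry_def a_def\<close>)
    also have "J_entry n \<xi> \<eta> q k (k - 1 + 1) = q k" using k by (simp add: J_entry_def)
    also have "J_entry n \<xi> \<eta> q k (b + 1) = - exp (\<eta> k)" using n k by (auto simp: J_entry_def b_def)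
    also have "v $ a = \<psi> (k - 1)" using n k by (auto simp: a_def \<psi> numeral_2_eq_2)
    also have "v $ (k - 1) = \<psi> k" using k by (simp add: \<psi>)
    also have "v $ b = \<psi> (k + 1)" using n k by (auto simp: b_def \<psi>)
    finally show ?thesis by simp
  qed
  finally show ?thesis by simp
qed

text \<open>
  The gauge \<open>\<phi>\<^sub>k = exp (\<Sum>j<k. log_h (x j)) * \<psi>\<^sub>k\<close> symmetrises the off-diagonal entries and turns the
  periodic boundary condition into \<open>S\<^sub>n u = diag (d\<^sub>1, d\<^sub>2) u\<close>.
\<close>

lemma eigenvalue_transfer:
  fixes x :: "nat \<Rightarrow> env"
  assumes n: "n \<ge> 3"
    and ev: "eigenvalue (map_mat complex_of_real (J_mat n (\<lambda>k. fst (x k)) (\<lambda>k. fst (snd (x k))) (\<lambda>k. pot (x k)))) z"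
  defines "d2 \<equiv> exp (\<Sum>j<n. log_h (x j))"
  defines "d1 \<equiv> d2 * exp (log_h (x n) - log_h (x 0))"
  shows "of_real (cc x 0 / cc x n + d1 * d2) = of_real d2 * S_entry x z n 0 0 + of_real d1 * S_entry x z n 1 1"
proof -
  let ?J = "J_mat n (\<lambda>k. fst (x k)) (\<lambda>k. fst (snd (x k))) (\<lambda>k. pot (x k))"
  obtain v where v: "v \<in> carrier_vec n" "v \<noteq> 0\<^sub>v n" and eig: "map_mat complex_of_real ?J *\<^sub>v v = z \<cdot>\<^sub>v v"
    using ev by (auto simp: eigenvalue_def eigenvector_def J_mat_def)
  define \<psi> where "\<psi> k = (if k = 0 then v $ (n - 1) else if k = Suc n then v $ 0 else v $ (k - 1))" for k
  define H where "H k = (\<Sum>j<k. log_h (x j))" for k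
  define \<phi> where "\<phi> k = of_real (exp (H k)) * \<psi> k" for k
  have recur: "\<phi> (Suc k) = ((of_real (pot (x k)) - z) * \<phi> k - of_real (cc x (k - 1)) * \<phi> (k - 1)) / of_real (cc x k)"
    if k: "1 \<le> k" "k \<le> n" for k
  proof -
    have row: "- of_real (exp (fst (x (k - 1)))) * \<psi> (k - 1) + of_real (pot (x k)) * \<psi> k
        - of_real (exp (fst (snd (x k)))) * \<psi> (k + 1) = z * \<psi> k"
      by (rule J_mat_row[OF n v(1) k eig \<psi>_def])
    \<comment> \<open>At each site \<open>\<xi> + log_h\<close> and \<open>\<eta> - log_h\<close>
      both equal \<open>log_c\<close>, which is why the gauge makes the two off-diagonal
      coefficients symmetric.\<close>
    have 1: "exp (H k) * exp (fst (x (k - 1))) = cc x (k - 1) * exp (H (k - 1))"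
    proof -
      have "H k = H (k - 1) + log_h (x (k - 1))" using k by (cases k) (auto simp: H_def)
      then show ?thesis by (simp add: exp_add[symmetric] log_h_def log_c_def) (simp add: field_simps)
    qed
    have 2: "exp (H k) * exp (fst (snd (x k))) = cc x k * exp (H (Suc k))"
      by (simp add: H_def exp_add[symmetric] log_h_def log_c_def) (simp add: field_simps)
    have "(of_real (pot (x k)) - z) * \<phi> k
        = of_real (exp (H k)) * (of_real (exp (fst (x (k - 1)))) * \<psi> (k - 1) + of_real (exp (fst (snd (x k)))) * \<psi> (k + 1))"
      using arg_cong[OF row, of "\<lambda>t. of_real (exp (H k)) * t"] unfolding \<phi>_def by (simp add: algebra_simps)
    also have "\<dots> = of_real (exp (H k) * exp (fst (x (k - 1)))) * \<psi> (k - 1)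
        + of_real (exp (H k) * exp (fst (snd (x k)))) * \<psi> (k + 1)" by (simp add: algebra_simps)
    also have "\<dots> = of_real (cc x (k - 1)) * \<phi> (k - 1) + of_real (cc x k) * \<phi> (Suc k)"
      unfolding 1 2 \<phi>_def by simp
    finally show ?thesis by (simp add: field_simps)
  qed
  have propagate: "\<phi> (Suc k) = S_entry x z k 0 0 * \<phi> 1 + S_entry x z k 0 1 * \<phi> 0 \<and> \<phi> k = S_entry x z k 1 0 * \<phi> 1 + S_entry x z k 1 1 * \<phi> 0"
    if "k \<le> n" for k
    using that
  proof (induction k)
    case (Suc k)
    then have IH: "\<phi> (Suc k) = S_entry x z k 0 0 * \<phi> 1 + S_entry x z k 0 1 * \<phi> 0" "\<phi> k = S_entry x z k 1 0 * \<phi> 1 + S_entry x z k 1 1 * \<phi> 0" by auto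
    have "\<phi> (Suc (Suc k)) = ((of_real (pot (x (Suc k))) - z) * \<phi> (Suc k) - of_real (cc x k) * \<phi> k) / of_real (cc x (Suc k))"
      using recur[of "Suc k"] Suc.prems by simp
    also have "\<dots> = S_entry x z (Suc k) 0 0 * \<phi> 1 + S_entry x z (Suc k) 0 1 * \<phi> 0"
      unfolding IH by (simp add: S_Suc) (simp add: field_simps)
    finally show ?case using IH(1) by (simp add: S_Suc)
  qed simp
  \<comment> \<open>From index 0 to \<open>n\<close> the gauge collects the sites 0 to
    \<open>n - 1\<close>, but from 1 to \<open>Suc n\<close> the sites 1 to \<open>n\<close>; this
    is the extra factor in \<open>d1\<close>.\<close>
  have d2: "\<phi> n = of_real d2 * \<phi> 0"
    using n by (simp add: \<phi>_def \<psi>_def d2_def H_def)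
  have d1: "\<phi> (Suc n) = of_real d1 * \<phi> 1"
  proof -
    have "exp (H (Suc n)) = d1 * exp (H 1)"
      by (simp add: d1_def d2_def H_def exp_add exp_diff)
    then have "\<phi> (Suc n) = of_real (d1 * exp (H 1)) * \<psi> (Suc n)" by (simp only: \<phi>_def)
    also have "\<psi> (Suc n) = \<psi> 1" using n by (simp add: \<psi>_def)
    finally show ?thesis by (simp add: \<phi>_def)
  qed
  \<comment> \<open>Two neighbouring values determine the whole solution, so if both vanished,
    \<open>v\<close> would be zero.\<close>
  have nz: "\<phi> 1 \<noteq> 0 \<or> \<phi> 0 \<noteq> 0"
  proof (rule ccontr)
    assume "\<not> ?thesis"
    then have "\<phi> 1 = 0" "\<phi> 0 = 0" by simp_all
    then have "\<phi> k = 0" if "k \<le> n" for k using propagate[OF that] by simp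
    then have "\<psi> k = 0" if "k \<le> n" for k using that by (simp add: \<phi>_def)
    then have "\<psi> (Suc i) = 0" if "i < n" for i using that by (simp add: Suc_le_eq)
    then have "v $ i = 0" if "i < n" for i using that by (simp add: \<psi>_def)
    then have "v = 0\<^sub>v n" using v(1) by (intro eq_vecI) auto
    with v(2) show False by simp
  qed
  have e1: "(S_entry x z n 0 0 - of_real d1) * \<phi> 1 + S_entry x z n 0 1 * \<phi> 0 = 0"
    using propagate[of n] d1 by (simp add: algebra_simps)
  have e2: "S_entry x z n 1 0 * \<phi> 1 + (S_entry x z n 1 1 - of_real d2) * \<phi> 0 = 0"
    using propagate[of n] d2 by (simp add: algebra_simps)
  define a b c d where "a = S_entry x z n 0 0 - of_real d1" and "b = S_entry x z n 0 1"
    and "c = S_entry x z n 1 0" and "d = S_entry x z n 1 1 - of_real d2"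
  note abcd = a_def b_def c_def d_def
  \<comment> \<open>Multiplication by the adjugate shows that the determinant annihilates a nonzero
    vector.\<close>
  have "(a * d - b * c) * \<phi> 1 = d * (a * \<phi> 1 + b * \<phi> 0) - b * (c * \<phi> 1 + d * \<phi> 0)"
    "(a * d - b * c) * \<phi> 0 = a * (c * \<phi> 1 + d * \<phi> 0) - c * (a * \<phi> 1 + b * \<phi> 0)"
    by (simp_all add: algebra_simps)
  then have "(a * d - b * c) * \<phi> 1 = 0" "(a * d - b * c) * \<phi> 0 = 0"
    unfolding e1[folded abcd] e2[folded abcd] by simp_all
  with nz have "a * d - b * c = 0" by auto
  then have "(S_entry x z n 0 0 * S_entry x z n 1 1 - S_entry x z n 0 1 * S_entry x z n 1 0) + of_real (d1 * d2)
      = of_real d2 * S_entry x z n 0 0 + of_real d1 * S_entry x z n 1 1" by (simp add: abcd algebra_simps)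
  then show ?thesis unfolding det_S by simp
qed

section \<open>Random environments\<close>

lemma measurable_log_c [measurable]: "log_c \<in> borel_measurable borel"
  unfolding log_c_def by (intro borel_measurable_continuous_onI continuous_intros) auto

lemma measurable_log_h [measurable]: "log_h \<in> borel_measurable borel"
  unfolding log_h_def by (intro borel_measurable_continuous_onI continuous_intros) auto

lemma measurable_pot [measurable]: "(\<lambda>e::env. pot e) \<in> borel_measurable borel"
  by (intro borel_measurable_continuous_onI continuous_intros)

locale random_environment = ergodic_system N seq_shift for N :: "(nat \<Rightarrow> env) measure" +
  assumes sets_N: "sets N = sets (\<Pi>\<^sub>M k\<in>UNIV. borel)"
    and integrable_pot: "integrable N (\<lambda>x. ln (1 + \<bar>pot (x 0)\<bar>))"
    and integrable_log_c: "integrable N (\<lambda>x. log_c (x 0))"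
    and integrable_log_h: "integrable N (\<lambda>x. log_h (x 0))"
begin

lemma measurable_coord [measurable]: "(\<lambda>x. x k) \<in> borel_measurable N"
  using measurable_component_singleton[of k UNIV "\<lambda>_. borel"]
  by (simp add: measurable_cong_sets[OF sets_N refl])

lemma integrable_coord:
  fixes f :: "env \<Rightarrow> real"
  assumes "integrable N (\<lambda>x. f (x 0))" shows "integrable N (\<lambda>x. f (x k))"
  using integrable_funpow[OF assms, of k] by (simp add: seq_shift_funpow)

lemma integral_coord:
  fixes f :: "env \<Rightarrow> real"
  assumes "integrable N (\<lambda>x. f (x 0))" shows "(LINT x|N. f (x k)) = (LINT x|N. f (x 0))"
  using integral_funpow[OF borel_measurable_integrable[OF assms], of k] by (simp add: seq_shift_funpow)

lemma measurable_S: "j < 2 \<Longrightarrow> (\<lambda>x. S_entry x z n 0 j) \<in> borel_measurable N \<and> (\<lambda>x. S_entry x z n 1 j) \<in> borel_measurable N"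
proof (induction n)
  case (Suc n)
  then have [measurable]: "(\<lambda>x. S_entry x z n 0 j) \<in> borel_measurable N" "(\<lambda>x. S_entry x z n 1 j) \<in> borel_measurable N"
    by auto
  show ?case unfolding S_Suc_0[OF Suc.prems] S_Suc_1[OF Suc.prems] by (intro conjI; measurable)
qed simp

lemma measurable_mat_norm_S [measurable]: "(\<lambda>x. mat_norm (S_path x z n)) \<in> borel_measurable N"
proof -
  have [measurable]: "(\<lambda>x. S_entry x z n 0 0) \<in> borel_measurable N" "(\<lambda>x. S_entry x z n 1 0) \<in> borel_measurable N"
    "(\<lambda>x. S_entry x z n 0 1) \<in> borel_measurable N" "(\<lambda>x. S_entry x z n 1 1) \<in> borel_measurable N"
    using measurable_S[of 0 z n] measurable_S[of 1 z n] by auto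
  show ?thesis unfolding mat_norm_S by measurable
qed

lemma measurable_A_norm [measurable]: "A_norm z \<in> borel_measurable N"
  unfolding A_norm_def by measurable

subsection \<open>Integrability\<close>

lemma integrable_sandwich:
  fixes f l u :: "(nat \<Rightarrow> env) \<Rightarrow> real"
  assumes "integrable N l" "integrable N u" "f \<in> borel_measurable N" "\<And>x. l x \<le> f x" "\<And>x. f x \<le> u x"
  shows "integrable N f"
proof (rule Bochner_Integration.integrable_bound)
  show "integrable N (\<lambda>x. \<bar>l x\<bar> + \<bar>u x\<bar>)" using assms by simp
  have "\<bar>f x\<bar> \<le> \<bar>l x\<bar> + \<bar>u x\<bar>" for x using assms(4)[of x] assms(5)[of x] by linarith
  then show "AE x in N. norm (f x) \<le> norm (\<bar>l x\<bar> + \<bar>u x\<bar>)" by simp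
qed (use assms in simp)

text \<open>By \<open>A_norm_mono\<close> with radius 1, this bounds the log-norm of the first
  transfer matrix on the whole unit disc around \<open>z\<close>.\<close>

definition step_bound :: "complex \<Rightarrow> (nat \<Rightarrow> env) \<Rightarrow> real" where
  "step_bound z x = ln (A_norm z x + 1 / cc x 1)"

lemma step_bound_nonneg: "step_bound z x \<ge> 0"
  unfolding step_bound_def using A_norm_ge_1[of z x] by (intro ln_ge_zero) (simp add: add_increasing2)

text \<open>The argument of the logarithm is bounded crudely by a product, so that the logarithm
  becomes a sum of integrable terms.\<close>

lemma step_bound_le:
  "step_bound z x \<le> \<bar>log_c (x 0)\<bar> + \<bar>log_c (x 1)\<bar> + ln (1 + \<bar>pot (x 1)\<bar>) + ln (3 + cmod z)"
proof -
  define a b p where "a = \<bar>log_c (x 0)\<bar>" and "b = \<bar>log_c (x 1)\<bar>" and "p = 1 + \<bar>pot (x 1)\<bar>"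
  have p: "p \<ge> 1" by (simp add: p_def)
  have ea: "exp a \<ge> 1" and eb: "exp b \<ge> 1" by (simp_all add: a_def b_def)
  have eab: "exp b \<le> exp a * exp b" "1 \<le> exp a * exp b"
    using mult_mono[OF ea order_refl, of "exp b"] mult_mono[OF ea eb] by auto
  have inv: "1 / cc x 1 \<le> exp b" "cc x 0 \<le> exp a"
    by (simp_all add: a_def b_def exp_minus[symmetric] inverse_eq_divide[symmetric])
  have q: "cmod (of_real (pot (x 1)) - z) \<le> \<bar>pot (x 1)\<bar> + cmod z"
    by (rule order_trans[OF norm_triangle_ineq4]) simp
  have "A_norm z x + 1 / cc x 1 \<le> exp a * exp b * (p * (3 + cmod z))"
  proof -
    have pz: "p + cmod z + 1 \<le> p * (3 + cmod z)"
      using p mult_right_mono[OF p norm_ge_zero[of z]] by (simp add: algebra_simps)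
    have "cmod (of_real (pot (x 1)) - z) / cc x 1 + 1 + 1 / cc x 1
        = (cmod (of_real (pot (x 1)) - z) + 1) * (1 / cc x 1) + 1" by (simp add: field_simps)
    also have "\<dots> \<le> (p + cmod z) * exp b + 1"
      using q p inv by (intro add_right_mono mult_mono) (simp_all add: p_def)
    also have "\<dots> \<le> (p + cmod z) * (exp a * exp b) + exp a * exp b"
      using eab p by (intro add_mono mult_left_mono) simp_all
    also have "\<dots> = (p + cmod z + 1) * (exp a * exp b)" by (simp add: algebra_simps)
    also have "\<dots> \<le> p * (3 + cmod z) * (exp a * exp b)" by (rule mult_right_mono[OF pz]) simp
    finally have 1: "cmod (of_real (pot (x 1)) - z) / cc x 1 + 1 + 1 / cc x 1
      \<le> p * (3 + cmod z) * (exp a * exp b)" .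
    have "cc x 0 / cc x 1 + 1 / cc x 1 = (cc x 0 + 1) * (1 / cc x 1)" by (simp add: field_simps)
    also have "\<dots> \<le> (exp a + exp a) * exp b"
      using inv ea by (intro mult_mono add_mono) simp_all
    also have "\<dots> = 2 * (exp a * exp b)" by simp
    also have "\<dots> \<le> p * (3 + cmod z) * (exp a * exp b)"
      using mult_mono[OF p, of 2 "3 + cmod z"] p norm_ge_zero[of z] by (intro mult_right_mono) simp_all
    finally have 2: "cc x 0 / cc x 1 + 1 / cc x 1 \<le> p * (3 + cmod z) * (exp a * exp b)" .
    show ?thesis using 1 2 by (simp add: A_norm_def max_def mult_ac)
  qed
  then have "step_bound z x \<le> ln (exp a * exp b * (p * (3 + cmod z)))"
    unfolding step_bound_def using A_norm_ge_1[of z x] by (intro ln_mono) (auto intro: add_pos_nonneg less_le_trans[of 0 1])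
  also have "\<dots> = a + b + (ln p + ln (3 + cmod z))"
    using p by (simp add: ln_mult_pos add_pos_nonneg)
  finally show ?thesis by (simp add: a_def b_def p_def)
qed

lemma integrable_step_bound: "integrable N (step_bound z)"
proof (rule integrable_sandwich)
  show "integrable N (\<lambda>x. 0)" by simp
  show "integrable N (\<lambda>x. \<bar>log_c (x 0)\<bar> + \<bar>log_c (x 1)\<bar> + ln (1 + \<bar>pot (x 1)\<bar>) + ln (3 + cmod z))"
    using integrable_log_c integrable_coord[OF integrable_log_c, of 1] integrable_coord[of "\<lambda>e. ln (1 + \<bar>pot e\<bar>)" 1]
      integrable_pot by simp
  show "step_bound z \<in> borel_measurable N" unfolding step_bound_def by measurable
qed (rule step_bound_nonneg step_bound_le)+

definition orbit_bound :: "complex \<Rightarrow> nat \<Rightarrow> (nat \<Rightarrow> env) \<Rightarrow> real" where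
  "orbit_bound z n x = (\<Sum>k<n. step_bound z ((seq_shift ^^ k) x))"

lemma integrable_orbit_bound: "integrable N (orbit_bound z n)"
  unfolding orbit_bound_def by (intro Bochner_Integration.integrable_sum integrable_funpow integrable_step_bound)

lemma orbit_bound_mono: "r \<le> n \<Longrightarrow> orbit_bound z r x \<le> orbit_bound z n x"
  unfolding orbit_bound_def by (rule sum_mono2) (auto simp: step_bound_nonneg)

text \<open>
  This majorant stands in for the supremum over the ball, whose measurability is not immediate.
\<close>

definition ball_bound :: "complex \<Rightarrow> real \<Rightarrow> nat \<Rightarrow> (nat \<Rightarrow> env) \<Rightarrow> real" where
  "ball_bound z \<rho> n x = ln (mat_norm (S_path x z n)
    + (\<Prod>k<n. A_norm z ((seq_shift ^^ k) x) + \<rho> / cc x (Suc k)) - (\<Prod>k<n. A_norm z ((seq_shift ^^ k) x)))"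

lemma ball_bound_0: "ball_bound z 0 n x = ln (mat_norm (S_path x z n))"
  by (simp add: ball_bound_def)

lemma A_norm_pos: "0 < A_norm z x"
  using A_norm_ge_1[of z x] by linarith

lemmas A_norm_nonneg = less_imp_le[OF A_norm_pos]

lemma ln_mat_norm_le_ball_bound:
  assumes "dist z w \<le> \<rho>"
  shows "ln (mat_norm (S_path x w n)) \<le> ball_bound z \<rho> n x"
  unfolding ball_bound_def by (intro ln_mono mat_norm_S_perturb[OF assms] mat_norm_S_pos
     less_le_trans[OF mat_norm_S_pos mat_norm_S_perturb[OF assms]])

text \<open>The norm is at most the subtracted product, so only the enlarged product remains, and
  its logarithm is a sum along the orbit.\<close>

lemma ball_bound_le:
  assumes "0 \<le> \<rho>" "\<rho> \<le> 1"
  shows "ball_bound z \<rho> n x \<le> orbit_bound z n x"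
proof -
  have "ball_bound z \<rho> n x \<le> ln (\<Prod>k<n. A_norm z ((seq_shift ^^ k) x) + 1 / cc ((seq_shift ^^ k) x) 1)"
    unfolding ball_bound_def
  proof (rule ln_mono)
    have "(\<Prod>k<n. A_norm z ((seq_shift ^^ k) x)) \<le> (\<Prod>k<n. A_norm z ((seq_shift ^^ k) x) + \<rho> / cc x (Suc k))"
      using assms by (intro prod_mono) (auto simp: A_norm_nonneg)
    then show "0 < mat_norm (S_path x z n)
        + (\<Prod>k<n. A_norm z ((seq_shift ^^ k) x) + \<rho> / cc x (Suc k)) - (\<Prod>k<n. A_norm z ((seq_shift ^^ k) x))"
      using mat_norm_S_pos[of x z n] by linarith
    have "(\<Prod>k<n. A_norm z ((seq_shift ^^ k) x) + \<rho> / cc x (Suc k))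
        \<le> (\<Prod>k<n. A_norm z ((seq_shift ^^ k) x) + 1 / cc ((seq_shift ^^ k) x) 1)"
      using assms by (intro prod_mono) (auto simp: A_norm_nonneg seq_shift_funpow divide_right_mono)
    then show "mat_norm (S_path x z n)
        + (\<Prod>k<n. A_norm z ((seq_shift ^^ k) x) + \<rho> / cc x (Suc k)) - (\<Prod>k<n. A_norm z ((seq_shift ^^ k) x))
        \<le> (\<Prod>k<n. A_norm z ((seq_shift ^^ k) x) + 1 / cc ((seq_shift ^^ k) x) 1)"
      using mat_norm_S_le_prod[of x z n] by linarith
  qed
  also have "\<dots> = orbit_bound z n x"
    unfolding orbit_bound_def step_bound_def
    by (rule ln_prod) (simp_all add: A_norm_pos add_pos_pos less_imp_neq[THEN not_sym])
  finally show ?thesis .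
qed

lemma ln_mat_norm_S_le:
  assumes "dist z w \<le> 1"
  shows "ln (mat_norm (S_path x w n)) \<le> orbit_bound z n x"
  using ln_mat_norm_le_ball_bound[OF assms] ball_bound_le[of 1] by (rule order_trans) simp_all

lemma ball_bound_lower:
  assumes "0 \<le> \<rho>"
  shows "(log_c (x 0) - log_c (x n)) / 2 \<le> ball_bound z \<rho> n x"
  using ln_mat_norm_S_lower ln_mat_norm_le_ball_bound[of z z \<rho>] by (rule order_trans) (simp add: assms)

lemma integrable_log_c_diff: "integrable N (\<lambda>x. (log_c (x 0) - log_c (x n)) / 2)"
  using integrable_coord[OF integrable_log_c] by simp

lemma measurable_ball_bound [measurable]: "ball_bound z \<rho> n \<in> borel_measurable N"
  unfolding ball_bound_def by measurable

lemma integrable_ball_bound: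
  assumes "0 \<le> \<rho>" "\<rho> \<le> 1"
  shows "integrable N (ball_bound z \<rho> n)"
  by (rule integrable_sandwich[OF integrable_log_c_diff[of n] integrable_orbit_bound[of z n]])
    (rule measurable_ball_bound ball_bound_lower ball_bound_le assms)+

lemma integrable_ln_mat_norm: "integrable N (\<lambda>x. ln (mat_norm (S_path x z n)))"
proof -
  have "ball_bound z 0 n = (\<lambda>x. ln (mat_norm (S_path x z n)))" by (rule ext) (rule ball_bound_0)
  then show ?thesis using integrable_ball_bound[of 0 z n] by simp
qed

text \<open>Dominated convergence: the two products merge as the radius shrinks, and the bounds from
  both sides are uniform for radii up to 1.\<close>

lemma ball_bound_tendsto:
  "(\<lambda>k. LINT x|N. ball_bound z (1 / real (Suc k)) n x) \<longlonglongrightarrow> (LINT x|N. ln (mat_norm (S_path x z n)))"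
proof (rule integral_dominated_convergence)
  show "integrable N (\<lambda>x. \<bar>(log_c (x 0) - log_c (x n)) / 2\<bar> + \<bar>orbit_bound z n x\<bar>)"
    using integrable_log_c_diff integrable_orbit_bound
    by (intro Bochner_Integration.integrable_add Bochner_Integration.integrable_abs)
  show "AE x in N. norm (ball_bound z (1 / real (Suc k)) n x) \<le> \<bar>(log_c (x 0) - log_c (x n)) / 2\<bar> + \<bar>orbit_bound z n x\<bar>" for k
  proof (rule AE_I2)
    fix x
    have "(log_c (x 0) - log_c (x n)) / 2 \<le> ball_bound z (1 / real (Suc k)) n x" by (rule ball_bound_lower) simp
    moreover have "ball_bound z (1 / real (Suc k)) n x \<le> orbit_bound z n x" by (rule ball_bound_le) simp_all
    ultimately show "norm (ball_bound z (1 / real (Suc k)) n x) \<le> \<bar>(log_c (x 0) - log_c (x n)) / 2\<bar> + \<bar>orbit_bound z n x\<bar>"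
      unfolding real_norm_def by linarith
  qed
  show "AE x in N. (\<lambda>k. ball_bound z (1 / real (Suc k)) n x) \<longlonglongrightarrow> ln (mat_norm (S_path x z n))"
  proof (rule AE_I2)
    fix x
    have "(\<lambda>k. mat_norm (S_path x z n)
        + (\<Prod>i<n. A_norm z ((seq_shift ^^ i) x) + 1 / real (Suc k) / cc x (Suc i)) - (\<Prod>i<n. A_norm z ((seq_shift ^^ i) x)))
      \<longlonglongrightarrow> mat_norm (S_path x z n)
        + (\<Prod>i<n. A_norm z ((seq_shift ^^ i) x) + 0 / cc x (Suc i)) - (\<Prod>i<n. A_norm z ((seq_shift ^^ i) x))"
      using LIMSEQ_Suc[OF lim_1_over_n]
      by (intro tendsto_diff tendsto_add tendsto_prod tendsto_divide tendsto_const) simp_all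
    then show "(\<lambda>k. ball_bound z (1 / real (Suc k)) n x) \<longlonglongrightarrow> ln (mat_norm (S_path x z n))"
      unfolding ball_bound_def using mat_norm_S_pos[of x z n] by (intro tendsto_ln) simp_all
  qed
qed measurable

subsection \<open>The Lyapunov exponent\<close>

definition lyap :: "complex \<Rightarrow> real" where
  "lyap z = lim (\<lambda>n. (LINT x|N. ln (mat_norm (S_path x z n))) / real n)"

text \<open>The cocycle relation and shift invariance make the means subadditive, and the
  determinant bound makes them nonnegative, so Fekete's argument applies.\<close>

lemma lyap_tendsto: "(\<lambda>n. (LINT x|N. ln (mat_norm (S_path x z n))) / real n) \<longlonglongrightarrow> lyap z"
  unfolding lyap_def
proof (rule convergent_LIMSEQ_iff[THEN iffD1, OF subadditive_convergent])
  fix m n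
  let ?L = "\<lambda>n x. ln (mat_norm (S_path x z n))"
  have "(LINT x|N. ?L (m + n) x) \<le> (LINT x|N. ?L n x + ?L m ((seq_shift ^^ n) x))"
  proof (rule integral_mono)
    show "integrable N (\<lambda>x. ?L n x + ?L m ((seq_shift ^^ n) x))"
      by (intro Bochner_Integration.integrable_add integrable_funpow[OF integrable_ln_mat_norm] integrable_ln_mat_norm)
    fix x
    have "?L (m + n) x \<le> ln (mat_norm (S_path ((seq_shift ^^ n) x) z m) * mat_norm (S_path x z n))"
      by (intro ln_mono mat_norm_S_add mat_norm_S_pos mult_pos_pos)
    then show "?L (m + n) x \<le> ?L n x + ?L m ((seq_shift ^^ n) x)"
      by (simp add: ln_mult_pos mat_norm_S_pos)
  qed (rule integrable_ln_mat_norm)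
  also have "\<dots> = (LINT x|N. ?L n x) + (LINT x|N. ?L m ((seq_shift ^^ n) x))"
    by (intro Bochner_Integration.integral_add integrable_funpow[OF integrable_ln_mat_norm] integrable_ln_mat_norm)
  also have "(LINT x|N. ?L m ((seq_shift ^^ n) x)) = (LINT x|N. ?L m x)"
    by (rule integral_funpow) measurable
  finally show "(LINT x|N. ?L (m + n) x) \<le> (LINT x|N. ?L m x) + (LINT x|N. ?L n x)" by simp
next
  fix n
  have "0 = (LINT x|N. (log_c (x 0) - log_c (x n)) / 2)"
    using integral_coord[OF integrable_log_c, of n] integrable_coord[OF integrable_log_c] by simp
  also have "\<dots> \<le> (LINT x|N. ln (mat_norm (S_path x z n)))"
    by (intro integral_mono integrable_log_c_diff integrable_ln_mat_norm ln_mat_norm_S_lower)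
  finally show "0 \<le> (LINT x|N. ln (mat_norm (S_path x z n)))" .
qed

text \<open>First a block length \<open>m\<close> is chosen whose mean log-norm at \<open>z\<close>
  is below \<open>m * c\<close>, then a radius so small that the mean of the majorant over the ball
  still is.\<close>

lemma growth_upper:
  assumes "lyap z < c"
  obtains \<rho> where "\<rho> > 0"
    "AE x in N. \<forall>\<^sub>F n in sequentially. \<forall>w\<in>ball z \<rho>. ln (mat_norm (S_path x w n)) < real n * c"
proof -
  from order_tendstoD(2)[OF lyap_tendsto assms] eventually_gt_at_top[of 0]
  have "\<forall>\<^sub>F n in sequentially. 0 < n \<and> (LINT x|N. ln (mat_norm (S_path x z n))) / real n < c"
    by eventually_elim simp
  from eventually_happens'[OF sequentially_bot this]
  obtain m where m: "m > 0" "(LINT x|N. ln (mat_norm (S_path x z m))) / real m < c" by blast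
  then have "(LINT x|N. ln (mat_norm (S_path x z m))) < real m * c" by (simp add: field_simps)
  from eventually_happens'[OF sequentially_bot order_tendstoD(2)[OF ball_bound_tendsto this]] obtain k
    where k: "(LINT x|N. ball_bound z (1 / real (Suc k)) m x) < real m * c" by blast
  define \<rho> where "\<rho> = 1 / real (Suc k)"
  have \<rho>: "0 < \<rho>" "\<rho> \<le> 1" by (simp_all add: \<rho>_def)
  have "AE x in N. \<forall>\<^sub>F n in sequentially. \<forall>w\<in>ball z \<rho>. ln (mat_norm (S_path x w n)) < real n * c"
  proof (rule subadditive_limsup[OF m(1), where F = "ball_bound z \<rho> m" and u = "orbit_bound z m"])
    fix w n k x
    have "ln (mat_norm (S_path x w (n + k)))
        \<le> ln (mat_norm (S_path ((seq_shift ^^ k) x) w n) * mat_norm (S_path x w k))"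
      by (intro ln_mono mat_norm_S_add mat_norm_S_pos mult_pos_pos)
    then show "ln (mat_norm (S_path x w (n + k)))
        \<le> ln (mat_norm (S_path x w k)) + ln (mat_norm (S_path ((seq_shift ^^ k) x) w n))"
      by (simp add: ln_mult_pos mat_norm_S_pos)
  next
    fix w x assume "w \<in> ball z \<rho>"
    then show "ln (mat_norm (S_path x w m)) \<le> ball_bound z \<rho> m x"
      by (intro ln_mat_norm_le_ball_bound) simp
  next
    fix w r x assume "w \<in> ball z \<rho>" "r < m"
    then show "ln (mat_norm (S_path x w r)) \<le> orbit_bound z m x"
      using \<rho> by (intro order_trans[OF ln_mat_norm_S_le orbit_bound_mono]) simp_all
  qed (use k \<rho> in \<open>simp_all add: \<rho>_def integrable_ball_bound integrable_orbit_bound\<close>)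
  with \<rho>(1) show ?thesis by (rule that)
qed

lemma growth_lower:
  assumes z: "Im z \<noteq> 0" and c: "c < lyap z"
  shows "AE x in N. \<forall>\<^sub>F n in sequentially. real n * c < ln (cmod (S_entry x z n 0 0))"
proof -
  define \<delta> where "\<delta> = \<bar>Im z\<bar>"
  have \<delta>: "\<delta> > 0" using z by (simp add: \<delta>_def)
  \<comment> \<open>\<open>exp (- e)\<close> is the loss factor of
    \<open>S00_superadditive\<close>.\<close>
  define e :: "env \<Rightarrow> real" where "e v = max (ln 2) (2 * log_c v - ln (\<delta>\<^sup>2 / 2))" for v
  have e_nonneg: "e v \<ge> 0" for v by (simp add: e_def le_max_iff_disj)
  have exp_e: "exp (- e (x k)) = min (1 / 2) ((Im z)\<^sup>2 / (2 * (cc x k)\<^sup>2))" for x :: "nat \<Rightarrow> env" and k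
  proof -
    have "exp (ln (\<delta>\<^sup>2 / 2) - 2 * log_c (x k)) = (Im z)\<^sup>2 / (2 * (cc x k)\<^sup>2)"
      using \<delta> by (simp add: exp_diff \<delta>_def exp_double)
    moreover have "exp (min a b) = min (exp a) (exp b)" for a b :: real by (simp add: min_def)
    moreover have "- e (x k) = min (- ln 2) (ln (\<delta>\<^sup>2 / 2) - 2 * log_c (x k))" by (simp add: e_def min_def max_def)
    ultimately show ?thesis by (simp add: exp_minus inverse_eq_divide)
  qed
  have int_e: "integrable N (\<lambda>x. e (x 0))"
    unfolding e_def using integrable_log_c by simp
  \<comment> \<open>The logarithm of either prefactor in \<open>mat_norm_S_le_S00\<close>.\<close>
  define \<kappa> :: "env \<Rightarrow> real" where "\<kappa> v = ln (1 + exp (log_c v) / \<delta>)" for v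
  have int_\<kappa>: "integrable N (\<lambda>x. \<kappa> (x 0))"
  proof (rule integrable_sandwich)
    show "integrable N (\<lambda>x. 0)" by simp
    show "integrable N (\<lambda>x. \<bar>log_c (x 0)\<bar> + ln (1 + 1 / \<delta>))" using integrable_log_c by simp
    show "(\<lambda>x. \<kappa> (x 0)) \<in> borel_measurable N" unfolding \<kappa>_def by measurable
    show "0 \<le> \<kappa> (x 0)" for x :: "nat \<Rightarrow> env" unfolding \<kappa>_def using \<delta> by (intro ln_ge_zero) simp
    show "\<kappa> (x 0) \<le> \<bar>log_c (x 0)\<bar> + ln (1 + 1 / \<delta>)" for x :: "nat \<Rightarrow> env"
    proof -
      have "1 + cc x 0 / \<delta> \<le> exp \<bar>log_c (x 0)\<bar> + exp \<bar>log_c (x 0)\<bar> / \<delta>"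
        using \<delta> by (intro add_mono divide_right_mono) simp_all
      then have "\<kappa> (x 0) \<le> ln (exp \<bar>log_c (x 0)\<bar> * (1 + 1 / \<delta>))"
        unfolding \<kappa>_def using \<delta> by (intro ln_mono) (simp_all add: add_pos_pos distrib_left)
      also have "\<dots> = \<bar>log_c (x 0)\<bar> + ln (1 + 1 / \<delta>)" using \<delta> by (simp add: ln_mult_pos add_pos_pos)
      finally show ?thesis .
    qed
  qed
  \<comment> \<open>The correction is read off at the first site, so splitting at \<open>k\<close>
    produces exactly the required \<open>e (x k)\<close> in the second block.\<close>
  define \<phi> where "\<phi> n x = e (x 0) - ln (cmod (S_entry x z n 0 0))" for n x
  have S_pos: "cmod (S_entry x z n 0 0) > 0" for n x using riccati_col0[OF z, of x n] by simp
  have sub: "\<phi> (n + k) x \<le> \<phi> k x + \<phi> n ((seq_shift ^^ k) x)" for n k x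
  proof -
    have "cmod (S_entry ((seq_shift ^^ k) x) z n 0 0) * cmod (S_entry x z k 0 0) * exp (- e (x k)) \<le> cmod (S_entry x z (n + k) 0 0)"
      unfolding exp_e by (rule S00_superadditive[OF z])
    then have "ln (cmod (S_entry ((seq_shift ^^ k) x) z n 0 0) * cmod (S_entry x z k 0 0) * exp (- e (x k)))
        \<le> ln (cmod (S_entry x z (n + k) 0 0))"
      by (intro ln_mono mult_pos_pos S_pos exp_gt_zero)
    moreover have "ln (cmod (S_entry ((seq_shift ^^ k) x) z n 0 0) * cmod (S_entry x z k 0 0) * exp (- e (x k)))
        = ln (cmod (S_entry ((seq_shift ^^ k) x) z n 0 0)) + ln (cmod (S_entry x z k 0 0)) - e (x k)"
      using S_pos[of "(seq_shift ^^ k) x" n] S_pos[of x k] by (simp add: ln_mult_pos)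
    ultimately show ?thesis by (simp add: \<phi>_def seq_shift_funpow)
  qed
  \<comment> \<open>Replacing the entry by the norm changes the mean only by a constant, so the mean
    of \<open>F n\<close> divided by \<open>n\<close> tends to \<open>- lyap z\<close>.\<close>
  define F where "F n x = e (x 0) + \<kappa> (x n) + \<kappa> (x 0) - ln (mat_norm (S_path x z n))" for n x
  have \<phi>_le: "\<phi> n x \<le> F n x" if "n > 0" for n x
  proof -
    have "ln (mat_norm (S_path x z n)) \<le> ln ((1 + cc x n / \<delta>) * (1 + cc x 0 / \<delta>) * cmod (S_entry x z n 0 0))"
      unfolding \<delta>_def by (intro ln_mono mat_norm_S_le_S00[OF z that] mat_norm_S_pos)
    also have "\<dots> = \<kappa> (x n) + \<kappa> (x 0) + ln (cmod (S_entry x z n 0 0))"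
      using \<delta> S_pos[of x n] by (simp add: ln_mult_pos \<kappa>_def add_pos_pos)
    finally show ?thesis by (simp add: \<phi>_def F_def)
  qed
  have int_F: "integrable N (F n)" for n
    unfolding F_def by (intro Bochner_Integration.integrable_add Bochner_Integration.integrable_diff
       int_e int_\<kappa> integrable_coord[OF int_\<kappa>] integrable_ln_mat_norm)
  let ?I = "\<lambda>n. LINT x|N. ln (mat_norm (S_path x z n))"
  define C where "C = (LINT x|N. e (x 0)) + 2 * (LINT x|N. \<kappa> (x 0))"
  have integral_F: "(LINT x|N. F n x) = C - ?I n" for n
    unfolding F_def C_def
    by (simp add: int_e int_\<kappa> integrable_coord[OF int_\<kappa>] integrable_ln_mat_norm integral_coord[OF int_\<kappa>, of n])
  have "(\<lambda>n. ?I n / real n - C / real n) \<longlonglongrightarrow> lyap z - 0"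
    by (intro tendsto_diff lyap_tendsto lim_const_over_n)
  from order_tendstoD(1)[OF this, of c] c have "\<forall>\<^sub>F n in sequentially. c < ?I n / real n - C / real n" by simp
  with eventually_gt_at_top[of 0] have "\<forall>\<^sub>F n in sequentially. 0 < n \<and> c < ?I n / real n - C / real n"
    by eventually_elim simp
  from eventually_happens'[OF sequentially_bot this]
  obtain m where m: "m > 0" "c < ?I m / real m - C / real m" by blast
  then have F_m: "(LINT x|N. F m x) < real m * (- c)" by (simp add: integral_F field_simps)
  define u where "u x = e (x 0) + (\<Sum>r<m. \<bar>F r x\<bar>)" for x
  have int_u: "integrable N u" unfolding u_def
    by (intro Bochner_Integration.integrable_add Bochner_Integration.integrable_sum int_e Bochner_Integration.integrable_abs int_F)
  have \<phi>_le_u: "\<phi> r x \<le> u x" if "r < m" for r x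
  proof (cases "r = 0")
    \<comment> \<open>The entry at index 0 is 1, so here \<open>\<phi>\<close> is just
      \<open>e\<close>, whereas \<open>\<phi>_le\<close> covers positive indices.\<close>
    case True
    then show ?thesis by (simp add: \<phi>_def u_def sum_nonneg)
  next
    case False
    then have "\<phi> r x \<le> \<bar>F r x\<bar>" using \<phi>_le[of r x] by simp
    also have "\<dots> \<le> (\<Sum>r<m. \<bar>F r x\<bar>)" by (rule member_le_sum) (use that in auto)
    finally show ?thesis using e_nonneg[of "x 0"] by (simp add: u_def)
  qed
  \<comment> \<open>The one-element index set reflects that \<open>z\<close> is fixed; uniformity
    near \<open>z\<close> comes later from \<open>S00_comparison\<close>.\<close>
  have "AE x in N. \<forall>\<^sub>F n in sequentially. \<forall>w\<in>UNIV :: unit set. \<phi> n x < real n * (- c)"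
  proof (rule subadditive_limsup[OF m(1), where F = "F m" and u = u])
    show "\<phi> (n + k) x \<le> \<phi> k x + \<phi> n ((seq_shift ^^ k) x)" for n k x by (rule sub)
    show "\<phi> m x \<le> F m x" for x by (rule \<phi>_le[OF m(1)])
    show "\<phi> r x \<le> u x" if "r < m" for r x by (rule \<phi>_le_u[OF that])
  qed (rule int_F int_u F_m)+
  then show ?thesis
  proof eventually_elim
    case (elim x)
    then show ?case
    proof eventually_elim
      case (elim n)
      then show ?case using e_nonneg[of "x 0"] by (simp add: \<phi>_def)
    qed
  qed
qed

end

section \<open>Exponential growth rates exclude eigenvalues\<close>

lemma eventually_sublinear:
  fixes f :: "nat \<Rightarrow> real"
  assumes "(\<lambda>n. f n / real n) \<longlonglongrightarrow> L" "\<epsilon> > 0"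
  shows "\<forall>\<^sub>F n in sequentially. \<bar>f n - real n * L\<bar> \<le> \<epsilon> * real n"
  using tendstoD[OF assms] eventually_gt_at_top[of 0]
proof eventually_elim
  case (elim n)
  then have "\<bar>f n / real n - L\<bar> * real n \<le> \<epsilon> * real n" by (intro mult_right_mono) (auto simp: dist_real_def)
  also have "\<bar>f n / real n - L\<bar> * real n = \<bar>(f n / real n - L) * real n\<bar>" by (simp add: abs_mult)
  also have "(f n / real n - L) * real n = f n - real n * L" using elim by (simp add: field_simps)
  finally show ?case .
qed

lemma eventually_const_sublinear: "\<epsilon> > 0 \<Longrightarrow> \<forall>\<^sub>F n in sequentially. \<bar>a\<bar> \<le> \<epsilon> * real n"
  using eventually_sublinear[of "\<lambda>_. a" 0 \<epsilon>] lim_const_over_n[of a] by simp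

definition typical_path :: "real \<Rightarrow> (nat \<Rightarrow> env) \<Rightarrow> bool" where
  "typical_path g x \<longleftrightarrow> (\<lambda>n. log_c (x n) / real n) \<longlonglongrightarrow> 0 \<and> (\<lambda>n. log_h (x n) / real n) \<longlonglongrightarrow> 0
     \<and> (\<lambda>n. (\<Sum>j<n. log_h (x j)) / real n) \<longlonglongrightarrow> g"

lemma eventually_typical_path:
  assumes "typical_path g x" "\<epsilon> > 0"
  shows "\<forall>\<^sub>F n in sequentially. n \<ge> 3 \<and> \<bar>log_c (x n)\<bar> \<le> \<epsilon> * real n \<and> \<bar>log_h (x n)\<bar> \<le> \<epsilon> * real n
     \<and> \<bar>log_c (x 0)\<bar> \<le> \<epsilon> * real n \<and> \<bar>log_h (x 0)\<bar> \<le> \<epsilon> * real n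
     \<and> \<bar>(\<Sum>j<n. log_h (x j)) - real n * g\<bar> \<le> \<epsilon> * real n \<and> ln 2 \<le> \<epsilon> * real n"
  using eventually_sublinear[of "\<lambda>n. log_c (x n)" 0 \<epsilon>] eventually_sublinear[of "\<lambda>n. log_h (x n)" 0 \<epsilon>]
    eventually_sublinear[of "\<lambda>n. \<Sum>j<n. log_h (x j)" g \<epsilon>] eventually_const_sublinear[of \<epsilon> "log_c (x 0)"]
    eventually_const_sublinear[of \<epsilon> "log_h (x 0)"] eventually_const_sublinear[of \<epsilon> "ln 2"]
    eventually_ge_at_top[of 3] assms
  unfolding typical_path_def by (auto elim!: eventually_elim2 simp: eventually_conj_iff)

abbreviation J_path :: "nat \<Rightarrow> (nat \<Rightarrow> env) \<Rightarrow> complex mat" where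
  "J_path n x \<equiv> map_mat complex_of_real (J_mat n (\<lambda>k. fst (x k)) (\<lambda>k. fst (snd (x k))) (\<lambda>k. snd (snd (x k))))"

lemma no_eigenvalues_slow_growth:
  assumes x: "typical_path g x" and c: "c < \<bar>g\<bar>"
    and growth: "\<forall>\<^sub>F n in sequentially. \<forall>w\<in>W. ln (mat_norm (S_path x w n)) < real n * c"
  shows "\<forall>\<^sub>F n in sequentially. \<forall>w\<in>W. \<not> eigenvalue (J_path n x) w"
proof -
  \<comment> \<open>The errors below add up to at most \<open>8 * (\<epsilon> * t)\<close>, less
    than the gap.\<close>
  define \<epsilon> where "\<epsilon> = (\<bar>g\<bar> - c) / 10"
  have "\<epsilon> > 0" using c by (simp add: \<epsilon>_def)
  from eventually_typical_path[OF x this] growth show ?thesis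
  proof eventually_elim
    case (elim n)
    define H where "H = (\<Sum>j<n. log_h (x j))"
    define t where "t = real n"
    have t: "t > 0" using elim by (simp add: t_def)
    have abs_bounds: "\<bar>log_c (x n)\<bar> \<le> \<epsilon> * t" "\<bar>log_h (x n)\<bar> \<le> \<epsilon> * t" "\<bar>log_c (x 0)\<bar> \<le> \<epsilon> * t"
      "\<bar>log_h (x 0)\<bar> \<le> \<epsilon> * t" "\<bar>H - t * g\<bar> \<le> \<epsilon> * t" "ln 2 \<le> \<epsilon> * t"
      using elim by (simp_all add: H_def t_def)
    note bounds = abs_bounds(1-5)[THEN abs_le_D1] abs_bounds(1-5)[THEN abs_le_D2] abs_bounds(6)
    have gap: "10 * (\<epsilon> * t) = t * \<bar>g\<bar> - t * c" "t * g \<le> t * \<bar>g\<bar>" "- (t * g) \<le> t * \<bar>g\<bar>" "\<epsilon> * t > 0"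
      using t c abs_ge_self[of "t * g"] abs_ge_minus_self[of "t * g"]
      by (simp_all add: \<epsilon>_def abs_mult field_simps)
    show ?case
    proof (intro ballI notI)
      fix w assume w: "w \<in> W" and "eigenvalue (J_path n x) w"
      then have "of_real (cc x 0 / cc x n + exp H * exp (log_h (x n) - log_h (x 0)) * exp H)
          = of_real (exp H) * S_entry x w n 0 0 + of_real (exp H * exp (log_h (x n) - log_h (x 0))) * S_entry x w n 1 1"
        using eigenvalue_transfer[of n x w] elim by (simp add: H_def)
      then have eq: "of_real (exp (log_c (x 0) - log_c (x n)) + exp (2 * H + log_h (x n) - log_h (x 0)))
          = of_real (exp H) * S_entry x w n 0 0 + of_real (exp (H + log_h (x n) - log_h (x 0))) * S_entry x w n 1 1"
        by (simp add: exp_add[symmetric] exp_diff[symmetric] mult_exp_exp algebra_simps)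
      define N where "N = mat_norm (S_path x w n)"
      have N: "cmod (S_entry x w n 0 0) \<le> N" "cmod (S_entry x w n 1 1) \<le> N"
        unfolding N_def mat_norm_S by (auto simp: le_max_iff_disj)
      have "ln N < t * c" using elim w by (auto simp: N_def t_def)
      then have N': "N < exp (t * c)" using mat_norm_S_pos[of x w n] by (metis N_def exp_less_cancel_iff exp_ln)
      have "exp (log_c (x 0) - log_c (x n)) + exp (2 * H + log_h (x n) - log_h (x 0))
          = cmod (of_real (exp (log_c (x 0) - log_c (x n)) + exp (2 * H + log_h (x n) - log_h (x 0))))"
        unfolding norm_of_real by simp
      also have "\<dots> \<le> exp H * cmod (S_entry x w n 0 0) + exp (H + log_h (x n) - log_h (x 0)) * cmod (S_entry x w n 1 1)"
        unfolding eq by (rule order_trans[OF norm_triangle_ineq]) (simp add: norm_mult)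
      also have "\<dots> \<le> exp (t * g + 3 * (\<epsilon> * t)) * exp (t * c) + exp (t * g + 3 * (\<epsilon> * t)) * exp (t * c)"
      proof (intro add_mono mult_mono)
        show "exp H \<le> exp (t * g + 3 * (\<epsilon> * t))" using bounds gap unfolding exp_le_cancel_iff by linarith
        show "exp (H + log_h (x n) - log_h (x 0)) \<le> exp (t * g + 3 * (\<epsilon> * t))"
          using bounds gap unfolding exp_le_cancel_iff by linarith
      qed (use N N' in auto)
      also have "\<dots> = exp (ln 2) * exp (t * g + 3 * (\<epsilon> * t) + t * c)" by (simp add: exp_add)
      also have "\<dots> \<le> exp (t * g + 4 * (\<epsilon> * t) + t * c)"
        using bounds unfolding exp_add[symmetric] exp_le_cancel_iff by linarith
      finally have upper: "exp (log_c (x 0) - log_c (x n)) + exp (2 * H + log_h (x n) - log_h (x 0))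
          \<le> exp (t * g + 4 * (\<epsilon> * t) + t * c)" .
      have "exp (log_c (x 0) - log_c (x n)) \<le> exp (t * g + 4 * (\<epsilon> * t) + t * c)"
        using upper exp_gt_zero[of "2 * H + log_h (x n) - log_h (x 0)"] by linarith
      then have 1: "log_c (x 0) - log_c (x n) \<le> t * g + 4 * (\<epsilon> * t) + t * c" by simp
      have "exp (2 * H + log_h (x n) - log_h (x 0)) \<le> exp (t * g + 4 * (\<epsilon> * t) + t * c)"
        using upper exp_gt_zero[of "log_c (x 0) - log_c (x n)"] by linarith
      then have 2: "2 * H + log_h (x n) - log_h (x 0) \<le> t * g + 4 * (\<epsilon> * t) + t * c" by simp
      show False
      \<comment> \<open>For \<open>g \<ge> 0\<close> the product of the boundary factors, with
        exponent near \<open>2 * t * g\<close>, is too large; otherwise the determinant, with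
        exponent near 0, is.\<close>
      proof (cases "t * g \<ge> 0")
        case True
        then have "t * \<bar>g\<bar> = t * g" using t by (simp add: zero_le_mult_iff)
        then show False using 2 bounds gap by linarith
      next
        case False
        then have "t * \<bar>g\<bar> = - (t * g)" using t by (simp add: zero_le_mult_iff)
        then show False using 1 bounds gap by linarith
      qed
    qed
  qed
qed

text \<open>The radius is fixed before the path, so that a single ball around \<open>z\<close> works
  for almost every path, although growth is known at \<open>z\<close> only.\<close>

lemma no_eigenvalues_fast_growth:
  assumes z: "Im z \<noteq> 0" and c: "\<bar>g\<bar> < c"
  obtains \<rho> where "\<rho> > 0"
    "\<And>x. typical_path g x \<Longrightarrow> \<forall>\<^sub>F n in sequentially. real n * c < ln (cmod (S_entry x z n 0 0)) \<Longrightarrow>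
      \<forall>\<^sub>F n in sequentially. \<forall>w\<in>ball z \<rho>. \<not> eigenvalue (J_path n x) w"
proof
  \<comment> \<open>The errors below add up to at most \<open>12 * (\<epsilon> * t)\<close>.\<close>
  define \<epsilon> where "\<epsilon> = (c - \<bar>g\<bar>) / 20"
  have \<epsilon>: "\<epsilon> > 0" using c by (simp add: \<epsilon>_def)
  \<comment> \<open>With this choice \<open>(1 - \<rho>) ^ n\<close> is
    \<open>exp (- \<epsilon> * n)\<close>, so moving from \<open>z\<close> to \<open>w\<close> costs
    one error unit.\<close>
  define \<rho> where "\<rho> = 1 - exp (- \<epsilon>)"
  have \<rho>: "0 < \<rho>" "\<rho> < 1" using \<epsilon> by (simp_all add: \<rho>_def)
  show "\<rho> * \<bar>Im z\<bar> > 0" using \<rho> z by simp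
  fix x assume x: "typical_path g x" and growth: "\<forall>\<^sub>F n in sequentially. real n * c < ln (cmod (S_entry x z n 0 0))"
  \<comment> \<open>A lower bound for \<open>\<bar>Im w\<bar>\<close> on the whole ball.\<close>
  define \<delta> where "\<delta> = (1 - \<rho>) * \<bar>Im z\<bar>"
  have \<delta>: "\<delta> > 0" using \<rho> z by (simp add: \<delta>_def)
  from eventually_typical_path[OF x \<epsilon>] growth eventually_const_sublinear[OF \<epsilon>, of "ln (\<delta>\<^sup>2 / 2)"]
  show "\<forall>\<^sub>F n in sequentially. \<forall>w\<in>ball z (\<rho> * \<bar>Im z\<bar>). \<not> eigenvalue (J_path n x) w"
  proof eventually_elim
    case (elim n)
    define H where "H = (\<Sum>j<n. log_h (x j))"
    define t where "t = real n"
    define r where "r = exp (log_h (x n) - log_h (x 0))"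
    have t: "t > 0" using elim by (simp add: t_def)
    have abs_bounds: "\<bar>log_c (x n)\<bar> \<le> \<epsilon> * t" "\<bar>log_h (x n)\<bar> \<le> \<epsilon> * t" "\<bar>log_c (x 0)\<bar> \<le> \<epsilon> * t"
      "\<bar>log_h (x 0)\<bar> \<le> \<epsilon> * t" "\<bar>H - t * g\<bar> \<le> \<epsilon> * t" "ln 2 \<le> \<epsilon> * t" "\<bar>ln (\<delta>\<^sup>2 / 2)\<bar> \<le> \<epsilon> * t"
      using elim by (simp_all add: H_def t_def)
    note bounds = abs_bounds(1-5)[THEN abs_le_D1] abs_bounds(1-5)[THEN abs_le_D2] abs_bounds(6)
      abs_bounds(7)[THEN abs_le_D1] abs_bounds(7)[THEN abs_le_D2]
    have gap: "20 * (\<epsilon> * t) = t * c - t * \<bar>g\<bar>" "t * g \<le> t * \<bar>g\<bar>" "- (t * g) \<le> t * \<bar>g\<bar>" "\<epsilon> * t > 0"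
      using t c abs_ge_self[of "t * g"] abs_ge_minus_self[of "t * g"]
      by (simp_all add: \<epsilon>_def abs_mult field_simps)
    show ?case
    proof (intro ballI notI)
      fix w assume w: "w \<in> ball z (\<rho> * \<bar>Im z\<bar>)" and ev: "eigenvalue (J_path n x) w"
      have dw: "dist z w \<le> \<rho> * \<bar>Im z\<bar>" using w by simp
      have "\<bar>Im z - Im w\<bar> \<le> \<rho> * \<bar>Im z\<bar>"
        using order_trans[OF abs_Im_le_cmod[of "z - w"]] dw by (simp add: dist_norm)
      then have Imw: "\<delta> \<le> \<bar>Im w\<bar>" by (simp add: \<delta>_def algebra_simps)
      then have w0: "Im w \<noteq> 0" using \<delta> by auto
      have "exp (log_c (x 0) - log_c (x n)) + exp (2 * H + log_h (x n) - log_h (x 0))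
          = cc x 0 / cc x n + exp H * r * exp H"
        by (simp add: r_def exp_diff[symmetric] mult_exp_exp algebra_simps)
      moreover have "of_real (cc x 0 / cc x n + exp H * r * exp H)
          = of_real (exp H) * S_entry x w n 0 0 + of_real (exp H * r) * S_entry x w n 1 1"
        using eigenvalue_transfer[of n x w] elim ev by (simp add: H_def r_def)
      ultimately have eq: "of_real (exp (log_c (x 0) - log_c (x n)) + exp (2 * H + log_h (x n) - log_h (x 0)))
          = of_real (exp H) * (S_entry x w n 0 0 + of_real r * S_entry x w n 1 1)"
        by (simp only: of_real_mult distrib_left mult.assoc)
      have S00: "exp (t * c - \<epsilon> * t) \<le> cmod (S_entry x w n 0 0)"
      proof -
        have "exp (t * c - \<epsilon> * t) = exp (- \<epsilon>) ^ n * exp (t * c)"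
          by (simp add: exp_of_nat_mult[symmetric] mult_exp_exp t_def algebra_simps)
        also have "exp (t * c) \<le> cmod (S_entry x z n 0 0)"
        proof -
          have "exp (t * c) \<le> exp (ln (cmod (S_entry x z n 0 0)))" using elim by (simp add: t_def)
          also have "\<dots> = cmod (S_entry x z n 0 0)" using riccati_col0[OF z, of x n] by simp
          finally show ?thesis .
        qed
        also have "exp (- \<epsilon>) ^ n * cmod (S_entry x z n 0 0) \<le> cmod (S_entry x w n 0 0)"
          using S00_comparison[OF z _ _ dw, of n x] \<rho> by (simp add: \<rho>_def)
        finally show ?thesis by simp
      qed
      have "exp (- (5 * (\<epsilon> * t))) \<le> 1 / 2"
      proof -
        have "exp (- (5 * (\<epsilon> * t))) \<le> exp (- ln 2)" using bounds gap unfolding exp_le_cancel_iff by linarith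
        then show ?thesis by (simp add: exp_minus)
      qed
      \<comment> \<open>Five error units: two from \<open>r\<close>, one each from
        \<open>cc x 0\<close> and \<open>cc x n\<close>, and one from
        \<open>ln (\<delta>\<^sup>2 / 2)\<close>.\<close>
      moreover have "exp (- (5 * (\<epsilon> * t))) \<le> (Im w)\<^sup>2 / (2 * r * cc x 0 * cc x n)"
      proof -
        have "exp (- (5 * (\<epsilon> * t))) \<le> exp (ln (\<delta>\<^sup>2 / 2) - (log_h (x n) - log_h (x 0) + log_c (x 0) + log_c (x n)))"
          using bounds gap unfolding exp_le_cancel_iff by linarith
        also have "\<dots> = \<delta>\<^sup>2 / 2 / exp (log_h (x n) - log_h (x 0) + log_c (x 0) + log_c (x n))"
          using \<delta> by (simp add: exp_diff)
        also have "\<dots> = \<delta>\<^sup>2 / (2 * r * cc x 0 * cc x n)" by (simp add: r_def exp_add mult.assoc)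
        also have "\<dots> \<le> (Im w)\<^sup>2 / (2 * r * cc x 0 * cc x n)"
          using Imw \<delta> power_mono[of \<delta> "\<bar>Im w\<bar>" 2] by (intro divide_right_mono) (simp_all add: r_def)
        finally show ?thesis .
      qed
      ultimately have "exp (- (5 * (\<epsilon> * t))) \<le> min (1 / 2) ((Im w)\<^sup>2 / (2 * r * cc x 0 * cc x n))" by simp
      then have "exp (t * c - \<epsilon> * t) * exp (- (5 * (\<epsilon> * t)))
          \<le> cmod (S_entry x w n 0 0) * min (1 / 2) ((Im w)\<^sup>2 / (2 * r * cc x 0 * cc x n))"
        by (intro mult_mono S00) auto
      also have "\<dots> \<le> cmod (S_entry x w n 0 0 + of_real r * S_entry x w n 1 1)"
        using elim by (intro S00_S11_lower[OF w0]) (auto simp: r_def)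
      finally have "exp H * (exp (t * c - \<epsilon> * t) * exp (- (5 * (\<epsilon> * t))))
          \<le> exp H * cmod (S_entry x w n 0 0 + of_real r * S_entry x w n 1 1)" by simp
      also have "\<dots> = cmod (of_real (exp H) * (S_entry x w n 0 0 + of_real r * S_entry x w n 1 1))"
        by (simp add: norm_mult)
      also have "\<dots> = exp (log_c (x 0) - log_c (x n)) + exp (2 * H + log_h (x n) - log_h (x 0))"
        unfolding eq[symmetric] norm_of_real by simp
      \<comment> \<open>The leading exponents of the two terms are 0 and \<open>2 * t * g\<close>,
        both at most \<open>t * g + t * \<bar>g\<bar>\<close>.\<close>
      also have "\<dots> \<le> exp (t * g + t * \<bar>g\<bar> + 4 * (\<epsilon> * t)) + exp (t * g + t * \<bar>g\<bar> + 4 * (\<epsilon> * t))"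
        by (intro add_mono iffD2[OF exp_le_cancel_iff]) (use bounds gap in linarith)+
      also have "\<dots> = exp (ln 2) * exp (t * g + t * \<bar>g\<bar> + 4 * (\<epsilon> * t))" by simp
      finally have "exp (H + (t * c - \<epsilon> * t + - (5 * (\<epsilon> * t)))) \<le> exp (ln 2 + (t * g + t * \<bar>g\<bar> + 4 * (\<epsilon> * t)))"
        by (simp only: mult_exp_exp)
      then have "H + (t * c - \<epsilon> * t + - (5 * (\<epsilon> * t))) \<le> ln 2 + (t * g + t * \<bar>g\<bar> + 4 * (\<epsilon> * t))"
        unfolding exp_le_cancel_iff .
      then show False using bounds gap by linarith
    qed
  qed
qed

section \<open>From local to compact\<close>

text \<open>Lindelof's theorem leaves countably many balls and hence a single null set for all
  \<open>K\<close>; compactness then leaves finitely many thresholds for each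
  \<open>K\<close>.\<close>

lemma AE_eventually_on_compacts:
  fixes D :: "complex set"
  assumes local: "\<And>z. z \<in> D \<Longrightarrow> \<exists>\<rho>>0. AE x in M. \<forall>\<^sub>F n in sequentially. \<forall>w\<in>ball z \<rho>. Q x n w"
  shows "AE x in M. \<forall>K. compact K \<and> K \<subseteq> D \<longrightarrow> (\<exists>n0. \<forall>n>n0. \<forall>w\<in>K. Q x n w)"
proof -
  have "\<forall>z\<in>D. \<exists>\<rho>>0. AE x in M. \<forall>\<^sub>F n in sequentially. \<forall>w\<in>ball z \<rho>. Q x n w"
    using local by (rule ballI)
  from bchoice[OF this] obtain \<rho> where \<rho>: "\<And>z. z \<in> D \<Longrightarrow> \<rho> z > 0"
    "\<And>z. z \<in> D \<Longrightarrow> AE x in M. \<forall>\<^sub>F n in sequentially. \<forall>w\<in>ball z (\<rho> z). Q x n w"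
    by blast
  obtain \<B> where \<B>: "\<B> \<subseteq> (\<lambda>z. ball z (\<rho> z)) ` D" "countable \<B>" "\<Union>\<B> = \<Union>((\<lambda>z. ball z (\<rho> z)) ` D)"
    using Lindelof[of "(\<lambda>z. ball z (\<rho> z)) ` D"] by blast
  have cover: "D \<subseteq> \<Union>\<B>" unfolding \<B>(3) using \<rho>(1) by (auto intro: centre_in_ball[THEN iffD2])
  have "AE x in M. \<forall>B\<in>\<B>. \<forall>\<^sub>F n in sequentially. \<forall>w\<in>B. Q x n w"
    using \<B>(1) \<rho>(2) by (subst AE_ball_countable[OF \<B>(2)]) blast
  then show ?thesis
  proof eventually_elim
    case (elim x)
    show ?case
    proof (intro allI impI, elim conjE)
      fix K assume K: "compact K" "K \<subseteq> D"
      obtain \<F> where \<F>: "\<F> \<subseteq> \<B>" "finite \<F>" "K \<subseteq> \<Union>\<F>"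
        by (rule compactE[OF K(1) order_trans[OF K(2) cover]]) (use \<B>(1) in auto)
      have "\<forall>\<^sub>F n in sequentially. \<forall>B\<in>\<F>. \<forall>w\<in>B. Q x n w"
        using elim \<F>(1) by (intro eventually_ball_finite[OF \<F>(2)]) blast
      then have "\<forall>\<^sub>F n in sequentially. \<forall>w\<in>K. Q x n w"
        by eventually_elim (use \<F>(3) in blast)
      then show "\<exists>n0. \<forall>n>n0. \<forall>w\<in>K. Q x n w" unfolding eventually_at_top_dense .
    qed
  qed
qed

section \<open>Almost sure absence of eigenvalues on the path space\<close>

context random_environment
begin

lemma AE_typical_path: "AE x in N. typical_path (LINT x|N. log_h (x 0)) x"
  using orbit_sublinear[OF integrable_log_c] orbit_sublinear[OF integrable_log_h] birkhoff[OF integrable_log_h]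
  by eventually_elim (simp add: typical_path_def bsum_eq_sum seq_shift_funpow)

lemma AE_no_eigenvalues_fast_growth:
  assumes z: "Im z \<noteq> 0" and c: "\<bar>LINT x|N. log_h (x 0)\<bar> < lyap z"
  shows "\<exists>\<rho>>0. AE x in N. \<forall>\<^sub>F n in sequentially. \<forall>w\<in>ball z \<rho>. \<not> eigenvalue (J_path n x) w"
proof -
  obtain d where d: "\<bar>LINT x|N. log_h (x 0)\<bar> < d" "d < lyap z" using c dense by blast
  obtain \<rho> where \<rho>: "\<rho> > 0"
    "\<And>x. typical_path (LINT x|N. log_h (x 0)) x \<Longrightarrow> \<forall>\<^sub>F n in sequentially. real n * d < ln (cmod (S_entry x z n 0 0)) \<Longrightarrow>
      \<forall>\<^sub>F n in sequentially. \<forall>w\<in>ball z \<rho>. \<not> eigenvalue (J_path n x) w"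
    using no_eigenvalues_fast_growth[OF z d(1)] by blast
  from AE_typical_path growth_lower[OF z d(2)]
  have "AE x in N. \<forall>\<^sub>F n in sequentially. \<forall>w\<in>ball z \<rho>. \<not> eigenvalue (J_path n x) w"
    by eventually_elim (rule \<rho>(2))
  with \<rho>(1) show ?thesis by blast
qed

lemma AE_no_eigenvalues_slow_growth:
  assumes c: "lyap z < \<bar>LINT x|N. log_h (x 0)\<bar>"
  shows "\<exists>\<rho>>0. AE x in N. \<forall>\<^sub>F n in sequentially. \<forall>w\<in>ball z \<rho>. \<not> eigenvalue (J_path n x) w"
proof -
  obtain d where d: "lyap z < d" "d < \<bar>LINT x|N. log_h (x 0)\<bar>" using c dense by blast
  obtain \<rho> where \<rho>: "\<rho> > 0"
    "AE x in N. \<forall>\<^sub>F n in sequentially. \<forall>w\<in>ball z \<rho>. ln (mat_norm (S_path x w n)) < real n * d"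
    by (rule growth_upper[OF d(1)])
  from AE_typical_path \<rho>(2)
  have "AE x in N. \<forall>\<^sub>F n in sequentially. \<forall>w\<in>ball z \<rho>. \<not> eigenvalue (J_path n x) w"
    by eventually_elim (rule no_eigenvalues_slow_growth[OF _ d(2)])
  with \<rho>(1) show ?thesis by blast
qed

theorem AE_no_eigenvalues_on_compacts:
  "AE x in N.
    (\<forall>K. compact K \<and> K \<subseteq> {z. lyap z > \<bar>LINT x|N. log_h (x 0)\<bar>} - \<real> \<longrightarrow>
       (\<exists>n0. \<forall>n>n0. \<forall>w\<in>K. \<not> eigenvalue (J_path n x) w)) \<and>
    (\<forall>K. compact K \<and> K \<subseteq> {z. lyap z < \<bar>LINT x|N. log_h (x 0)\<bar>} \<longrightarrow>
       (\<exists>n0. \<forall>n>n0. \<forall>w\<in>K. \<not> eigenvalue (J_path n x) w))"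
proof (intro AE_conjI AE_eventually_on_compacts)
  fix z assume "z \<in> {z. lyap z > \<bar>LINT x|N. log_h (x 0)\<bar>} - \<real>"
  then show "\<exists>\<rho>>0. AE x in N. \<forall>\<^sub>F n in sequentially. \<forall>w\<in>ball z \<rho>. \<not> eigenvalue (J_path n x) w"
    by (intro AE_no_eigenvalues_fast_growth) (simp_all add: complex_is_Real_iff)
next
  fix z assume "z \<in> {z. lyap z < \<bar>LINT x|N. log_h (x 0)\<bar>}"
  then show "\<exists>\<rho>>0. AE x in N. \<forall>\<^sub>F n in sequentially. \<forall>w\<in>ball z \<rho>. \<not> eigenvalue (J_path n x) w"
    by (intro AE_no_eigenvalues_slow_growth) simp
qed

end

section \<open>Passage to the path space\<close>

lemma measurable_path:
  assumes "\<And>k. X k \<in> borel_measurable M"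
  shows "(\<lambda>\<omega> k. X k \<omega>) \<in> measurable M (\<Pi>\<^sub>M k\<in>(UNIV::nat set). borel)"
  by (rule measurable_PiM_single') (use assms in auto)

lemma measurable_seq_shift:
  "seq_shift \<in> measurable (\<Pi>\<^sub>M k\<in>(UNIV::nat set). borel) (\<Pi>\<^sub>M k\<in>(UNIV::nat set). borel)"
  unfolding seq_shift_def
  by (rule measurable_PiM_single') (auto intro: measurable_component_singleton)

text \<open>Stationarity is invariance of the law under the shift. The product space consists of all
  sequences, so invariance of a set within it is the condition in
  \<open>ergodic_process\<close>.\<close>

lemma ergodic_system_path_law:
  assumes M: "prob_space M" and stat: "stationary_process M X" and erg: "ergodic_process M X"
  shows "ergodic_system (path_law M X) seq_shift"
proof -
  have X: "\<And>k. X k \<in> borel_measurable M" and inv: "path_law M (\<lambda>k. X (Suc k)) = path_law M X"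
    using stat by (auto simp: stationary_process_def)
  note [measurable] = measurable_path[of X, OF X] measurable_seq_shift
  interpret prob_space "path_law M X"
    unfolding path_law_def by (rule prob_space.prob_space_distr[OF M]) measurable
  show ?thesis
  proof
    show "seq_shift \<in> measurable (path_law M X) (path_law M X)"
      unfolding path_law_def by measurable
    have "distr (path_law M X) (path_law M X) seq_shift = distr (path_law M X) (\<Pi>\<^sub>M k\<in>UNIV. borel) seq_shift"
      by (rule distr_cong) (auto simp: path_law_def)
    also have "\<dots> = distr M (\<Pi>\<^sub>M k\<in>UNIV. borel) (seq_shift \<circ> (\<lambda>\<omega> k. X k \<omega>))"
      unfolding path_law_def by (rule distr_distr) measurable
    also have "seq_shift \<circ> (\<lambda>\<omega> k. X k \<omega>) = (\<lambda>\<omega> k. X (Suc k) \<omega>)" by (auto simp: seq_shift_def)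
    finally show "distr (path_law M X) (path_law M X) seq_shift = path_law M X"
      using inv by (simp add: path_law_def)
  next
    fix A assume "A \<in> sets (path_law M X)" "seq_shift -` A \<inter> space (path_law M X) = A"
    then show "prob A \<in> {0, 1}"
      using erg by (simp add: ergodic_process_def path_law_def space_PiM)
  qed
qed

theorem theorem2p1:
  fixes M :: "'a measure"
    and \<xi> \<eta> q :: "nat \<Rightarrow> 'a \<Rightarrow> real"
  assumes "prob_space M"
    and "stationary_process M (\<lambda>k \<omega>. (\<xi> k \<omega>, \<eta> k \<omega>, q k \<omega>))"
    and "ergodic_process M (\<lambda>k \<omega>. (\<xi> k \<omega>, \<eta> k \<omega>, q k \<omega>))"
    and "integrable M (\<lambda>\<omega>. ln (1 + \<bar>q 0 \<omega>\<bar>))"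
    and "integrable M (\<xi> 0)"
    and "integrable M (\<eta> 0)"
  shows "AE \<omega> in M.
    (\<forall>K1. compact K1 \<and> K1 \<subseteq> D1 M \<xi> \<eta> q - \<real> \<longrightarrow>
       (\<exists>n1. \<forall>n>n1. \<forall>z\<in>K1.
          \<not> eigenvalue (map_mat complex_of_real
               (J_mat n (\<lambda>k. \<xi> k \<omega>) (\<lambda>k. \<eta> k \<omega>) (\<lambda>k. q k \<omega>))) z)) \<and>
    (\<forall>K2. compact K2 \<and> K2 \<subseteq> D2 M \<xi> \<eta> q \<longrightarrow>
       (\<exists>n2. \<forall>n>n2. \<forall>z\<in>K2.
          \<not> eigenvalue (map_mat complex_of_real
               (J_mat n (\<lambda>k. \<xi> k \<omega>) (\<lambda>k. \<eta> k \<omega>) (\<lambda>k. q k \<omega>))) z))"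
proof -
  define X where "X k \<omega> = (\<xi> k \<omega>, \<eta> k \<omega>, q k \<omega>)" for k \<omega>
  \<comment> \<open>The claim concerns the realised sequence alone, so it is proved for its law, on
    which the shift acts.\<close>
  define N where "N = path_law M X"
  have X_meas: "\<And>k. X k \<in> borel_measurable M"
    using assms(2) by (simp add: stationary_process_def X_def[abs_def])
  note path_meas [measurable] = measurable_path[of X, OF X_meas]
  interpret N: ergodic_system N seq_shift
    unfolding N_def using assms(1-3) by (intro ergodic_system_path_law) (simp_all add: X_def[abs_def])
  have sets_N: "sets N = sets (\<Pi>\<^sub>M k\<in>UNIV. borel)" by (simp add: N_def path_law_def)
  have coord [measurable]: "(\<lambda>x. x k) \<in> borel_measurable (\<Pi>\<^sub>M k\<in>(UNIV::nat set). (borel :: env measure))" for k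
    by (rule measurable_component_singleton) simp
  have integrable_N: "integrable N f \<longleftrightarrow> integrable M (\<lambda>\<omega>. f (\<lambda>k. X k \<omega>))"
    if "f \<in> borel_measurable (\<Pi>\<^sub>M k\<in>(UNIV::nat set). borel)" for f :: "(nat \<Rightarrow> env) \<Rightarrow> real"
    unfolding N_def path_law_def using that by (intro integrable_distr_eq) measurable
  have integral_N: "(LINT x|N. f x) = (LINT \<omega>|M. f (\<lambda>k. X k \<omega>))"
    if "f \<in> borel_measurable (\<Pi>\<^sub>M k\<in>(UNIV::nat set). borel)" for f :: "(nat \<Rightarrow> env) \<Rightarrow> real"
    unfolding N_def path_law_def using that by (intro integral_distr) measurable
  interpret E: random_environment N
  proof
    show "sets N = sets (\<Pi>\<^sub>M k\<in>UNIV. borel)" by (rule sets_N)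
    show "integrable N (\<lambda>x. ln (1 + \<bar>pot (x 0)\<bar>))"
      using assms(4) by (subst integrable_N, measurable) (simp add: X_def)
    show "integrable N (\<lambda>x. log_c (x 0))"
      using assms(5,6) by (subst integrable_N, measurable) (simp add: X_def log_c_def)
    show "integrable N (\<lambda>x. log_h (x 0))"
      using assms(5,6) by (subst integrable_N, measurable) (simp add: X_def log_h_def)
  qed
  have lyap: "E.lyap z = lyapunov M \<xi> \<eta> q z" for z
  proof -
    have "(LINT x|N. ln (mat_norm (S_path x z n))) = (LINT \<omega>|M. ln (mat_norm (S_path (\<lambda>k. X k \<omega>) z n)))" for n
      using E.measurable_mat_norm_S[of z n]
      by (intro integral_N borel_measurable_ln) (simp add: measurable_cong_sets[OF sets_N refl])
    then show ?thesis by (simp add: E.lyap_def lyapunov_def X_def)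
  qed
  have g: "(LINT x|N. log_h (x 0)) = asym_g M \<xi> \<eta>"
    by (subst integral_N, measurable) (simp add: asym_g_def X_def log_h_def)
  have "AE x in N.
    (\<forall>K. compact K \<and> K \<subseteq> D1 M \<xi> \<eta> q - \<real> \<longrightarrow>
       (\<exists>n0. \<forall>n>n0. \<forall>w\<in>K. \<not> eigenvalue (J_path n x) w)) \<and>
    (\<forall>K. compact K \<and> K \<subseteq> D2 M \<xi> \<eta> q \<longrightarrow>
       (\<exists>n0. \<forall>n>n0. \<forall>w\<in>K. \<not> eigenvalue (J_path n x) w))"
    using E.AE_no_eigenvalues_on_compacts unfolding lyap g D1_def D2_def .
  \<comment> \<open>Null sets of the law pull back to null sets of \<open>M\<close>, which carries
    over even a statement about uncountably many compact sets.\<close>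
  from AE_distrD[OF path_meas this[unfolded N_def path_law_def]] show ?thesis by (simp add: X_def)
qed

end
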